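(* Let $0<\sigma_{\min}<1$ and let $h\in C^1(\mathbb{R})$, not identically zero, satisfy, for all $t\in\mathbb{R}$, $|h(t)|\le \frac{\psi_h(t)}{1+|t|}$ and $|h'(t)|\le\frac{\varphi_h(t)}{1+t^2}$, where $\psi_h,\varphi_h$ are continuous, non-negative and bounded functions on $\mathbb{R}$. Let $\sigma,\kappa\in\Phi_{\sigma_{\min}}$. Then there is a constant $C_2$, depending on $h,\sigma,\kappa,\sigma_{\min}$, such that for every $F\in L^2(\mathbb{R}^2)$, $$\|\mathcal{L}_\sigma^\dagger F-\mathcal{L}_\kappa^\dagger F\|_2\le C_2\,\|\sigma-\kappa\|_\infty\,\|F\|_{L^2(\mathbb{R}^2)}.$$
   Context: For $0<\sigma_{\min}<1$, $\Phi_{\sigma_{\min}}$ denotes the class of continuous functions $\sigma:\mathbb{R}\to\mathbb{R}$ with $\sigma(t)\ge\sigma_{\min}$ for all $t$ and $\sigma(t)\to1$ as $t\to\pm\infty$. For $\sigma\in\Phi_{\sigma_{\min}}$, a window $h$, and $t,\omega\in\mathbb{R}$, put $h_{t,\omega,\sigma}(x)=\sqrt{\sigma(t)}\,e^{2i\pi\omega x}\,h(\sigma(t)(x-t))$, and for $f\in L^2(\mathbb{R})$ put $\mathcal{L}_\sigma f(t,\omega)=\langle f,h_{t,\omega,\sigma}\rangle$, where $\langle f,g\rangle=\int_{\mathbb{R}}f\,\overline{g}$. Under the stated hypotheses $\mathcal{L}_\sigma:L^2(\mathbb{R})\to L^2(\mathbb{R}^2)$ is linear and bounded; $\mathcal{L}_\sigma^*:L^2(\mathbb{R}^2)\to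 L^2(\mathbb{R})$ is its adjoint. The left inverse $\mathcal{L}_\sigma^\dagger:L^2(\mathbb{R}^2)\to L^2(\mathbb{R})$ is defined by $\mathcal{L}_\sigma^\dagger F(x)=\frac{1}{k_\sigma(x)}(\mathcal{L}_\sigma^*F)(x)$, where $k_\sigma(x)=\int_{\mathbb{R}}\sigma(t)\,|h(\sigma(t)(x-t))|^2\,dt$, which is bounded from below away from $0$. $\|\cdot\|_p$ is the $L^p(\mathbb{R})$ norm. *)

theory Defs
  imports "HOL-Probability.Probability"
begin

text \<open>Elements of \<open>L\<^sup>2(M)\<close> are represented by square-integrable functions; an almost-everywhere
  equivalence class is represented by any of its Borel members.\<close>

definition L2_space :: "'a measure \<Rightarrow> ('a \<Rightarrow> complex) set" where
  "L2_space M = {f \<in> borel_measurable M. integrable M (\<lambda>x. (cmod (f x))\<^sup>2)}"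

definition L2_inner :: "'a measure \<Rightarrow> ('a \<Rightarrow> complex) \<Rightarrow> ('a \<Rightarrow> complex) \<Rightarrow> complex" where
  "L2_inner M f g = (LINT x|M. f x * cnj (g x))"

text \<open>Only meaningful on \<open>L2_space M\<close>: the Bochner integral is 0 outside its domain, so a norm
  bound has to be accompanied by membership in \<open>L2_space M\<close>.\<close>

definition L2_norm :: "'a measure \<Rightarrow> ('a \<Rightarrow> complex) \<Rightarrow> real" where
  "L2_norm M f = sqrt (LINT x|M. (cmod (f x))\<^sup>2)"

definition Linf_norm :: "(real \<Rightarrow> real) \<Rightarrow> real" where
  "Linf_norm f = real_of_ereal (esssup lborel (\<lambda>t. ereal \<bar>f t\<bar>))"

text \<open>For a bounded linear \<open>T\<close> from \<open>L\<^sup>2(M)\<close> to \<open>L\<^sup>2(N)\<close>, the value of the adjoint at \<open>F\<close> exists and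
  is unique up to almost-everywhere equality; the choice operator picks a representative.\<close>

definition L2_adjoint ::
    "'a measure \<Rightarrow> 'b measure \<Rightarrow> (('a \<Rightarrow> complex) \<Rightarrow> ('b \<Rightarrow> complex)) \<Rightarrow> ('b \<Rightarrow> complex) \<Rightarrow> 'a \<Rightarrow> complex" where
  "L2_adjoint M N T F =
     (SOME G. G \<in> L2_space M \<and> (\<forall>f\<in>L2_space M. L2_inner N (T f) F = L2_inner M f G))"

definition Phi_class :: "real \<Rightarrow> (real \<Rightarrow> real) set" where
  "Phi_class \<sigma>min = {\<sigma>. continuous_on UNIV \<sigma> \<and> (\<forall>t. \<sigma> t \<ge> \<sigma>min) \<and>
     (\<sigma> \<longlongrightarrow> 1) at_top \<and> (\<sigma> \<longlongrightarrow> 1) at_bot}"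

definition atom :: "(real \<Rightarrow> complex) \<Rightarrow> (real \<Rightarrow> real) \<Rightarrow> real \<Rightarrow> real \<Rightarrow> real \<Rightarrow> complex" where
  "atom h \<sigma> t \<omega> x =
     complex_of_real (sqrt (\<sigma> t)) * exp (2 * \<i> * complex_of_real pi * complex_of_real \<omega> * complex_of_real x)
       * h (\<sigma> t * (x - t))"

definition transform ::
    "(real \<Rightarrow> complex) \<Rightarrow> (real \<Rightarrow> real) \<Rightarrow> (real \<Rightarrow> complex) \<Rightarrow> real \<times> real \<Rightarrow> complex" where
  "transform h \<sigma> f = (\<lambda>(t, \<omega>). L2_inner lborel f (atom h \<sigma> t \<omega>))"

definition frame_weight :: "(real \<Rightarrow> complex) \<Rightarrow> (real \<Rightarrow> real) \<Rightarrow> real \<Rightarrow> real" where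
  "frame_weight h \<sigma> x = (LINT t|lborel. \<sigma> t * (cmod (h (\<sigma> t * (x - t))))\<^sup>2)"

definition left_inverse ::
    "(real \<Rightarrow> complex) \<Rightarrow> (real \<Rightarrow> real) \<Rightarrow> (real \<times> real \<Rightarrow> complex) \<Rightarrow> real \<Rightarrow> complex" where
  "left_inverse h \<sigma> F x =
     complex_of_real (1 / frame_weight h \<sigma> x) * L2_adjoint lborel lborel (transform h \<sigma>) F x"

end

theory Submission
  imports Defs
begin

text \<open>For fixed \<open>t\<close> the function \<open>\<omega> \<mapsto> \<L>\<^sub>\<sigma> f(t, \<omega>)\<close> is the Fourier transform of
  \<open>x \<mapsto> f(x)\<close> times the conjugate of \<open>p\<^sub>\<sigma>(t, x) = \<surd>\<sigma>(t) h(\<sigma>(t)(x - t))\<close>. By Bessel's inequality, every kernel with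
  \<open>\<bar>p(t, x)\<bar> \<le> c / (1 + m\<bar>x - t\<bar>)\<close> gives an operator of norm at most \<open>c\<close> times a constant depending on \<open>m\<close>,
  and the adjoint inherits this bound. The kernel \<open>p\<^sub>\<sigma>\<close> satisfies such a bound because of the decay of \<open>h\<close>;
  so does \<open>p\<^sub>\<sigma> - p\<^sub>\<kappa>\<close>, with \<open>c\<close> proportional to \<open>\<parallel>\<sigma> - \<kappa>\<parallel>\<^sub>\<infinity>\<close>, by the mean value inequality applied to
  \<open>s \<mapsto> \<surd>s h(s u)\<close>. The same estimates make \<open>k\<^sub>\<sigma>\<close> Lipschitz in \<open>\<sigma>\<close>, and the claim follows by writing the
  difference of the left inverses as
  \<open>(1/k\<^sub>\<sigma> - 1/k\<^sub>\<kappa>) \<L>\<^sub>\<sigma>\<^sup>* F + (1/k\<^sub>\<kappa>) (\<L>\<^sub>\<sigma>\<^sup>* F - \<L>\<^sub>\<kappa>\<^sup>* F)\<close>.\<close>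

section \<open>Square-integrable functions and the Riesz representation\<close>

text \<open>Evaluate the quadratic at its minimiser \<open>- b / c\<close> when \<open>c\<close> is
  nonzero; for \<open>c = 0\<close> a nonzero slope would push the affine function down to -1. This
  serves both Cauchy-Schwarz and the variational argument in \<open>L2_Riesz\<close>.\<close>

lemma quadratic_nonneg_imp_discriminant:
  fixes a b c :: real
  assumes nonneg: "\<And>s. 0 \<le> a + 2 * s * b + s\<^sup>2 * c" and "0 \<le> c"
  shows "b\<^sup>2 \<le> a * c"
proof (cases "c = 0")
  case True
  have "b = 0"
  proof (rule ccontr)
    assume "b \<noteq> 0"
    then show False
      using nonneg[of "- (a + 1) / (2 * b)"] True by (simp add: field_simps)
  qed
  then show ?thesis using True by simp
next
  case False
  have "0 \<le> (a + 2 * (- b / c) * b + (- b / c)\<^sup>2 * c) * c"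
    using nonneg[of "- b / c"] \<open>0 \<le> c\<close> by (intro mult_nonneg_nonneg) auto
  also have "\<dots> = a * c - b\<^sup>2"
    using False by (simp add: field_simps power2_eq_square)
  finally show ?thesis by simp
qed

section \<open>Arithmetic of square-integrable functions\<close>

lemma L2_space_measurable : "f \<in> L2_space M \<Longrightarrow> f \<in> borel_measurable M"
  by (simp add: L2_space_def)

lemma L2_space_integrable: "f \<in> L2_space M \<Longrightarrow> integrable M (\<lambda>x. (cmod (f x))\<^sup>2)"
  by (simp add: L2_space_def)

lemma borel_measurable_cnj [measurable]: "cnj \<in> borel_measurable borel"
  by (intro borel_measurable_continuous_onI continuous_intros)

lemma L2_inner_integrable:
  assumes f: "f \<in> L2_space M" and g: "g \<in> L2_space M"
  shows "integrable M (\<lambda>x. f x * cnj (g x))"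
proof (rule Bochner_Integration.integrable_bound)
  show "integrable M (\<lambda>x. (cmod (f x))\<^sup>2 + (cmod (g x))\<^sup>2)"
    using f g by (intro Bochner_Integration.integrable_add L2_space_integrable)
  note [measurable] = L2_space_measurable[OF f] L2_space_measurable[OF g]
  show "(\<lambda>x. f x * cnj (g x)) \<in> borel_measurable M"
    by measurable
  have "a * b \<le> a\<^sup>2 + b\<^sup>2" if "0 \<le> a" "0 \<le> b" for a b :: real
    using that sum_squares_bound[of a b] mult_nonneg_nonneg[of a b] by linarith
  then show "AE x in M. norm (f x * cnj (g x)) \<le> norm ((cmod (f x))\<^sup>2 + (cmod (g x))\<^sup>2)"
    by (auto simp: norm_mult)
qed

lemma L2_space_cmult: "f \<in> L2_space M \<Longrightarrow> (\<lambda>x. c * f x) \<in> L2_space M"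
  by (auto simp: L2_space_def norm_mult power_mult_distrib)

lemma L2_space_add:
  assumes f: "f \<in> L2_space M" and g: "g \<in> L2_space M"
  shows "(\<lambda>x. f x + g x) \<in> L2_space M"
proof -
  have "integrable M (\<lambda>x. (cmod (f x + g x))\<^sup>2)"
  proof (rule Bochner_Integration.integrable_bound)
    show "integrable M (\<lambda>x. 2 * ((cmod (f x))\<^sup>2 + (cmod (g x))\<^sup>2))"
      using f g by (intro Bochner_Integration.integrable_add L2_space_integrable
          Bochner_Integration.integrable_mult_right)
    note [measurable] = L2_space_measurable[OF f] L2_space_measurable[OF g]
    show "(\<lambda>x. (cmod (f x + g x))\<^sup>2) \<in> borel_measurable M"
      by measurable
    have "(cmod (a + b))\<^sup>2 \<le> 2 * ((cmod a)\<^sup>2 + (cmod b)\<^sup>2)" for a b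
    proof -
      have "(cmod (a + b))\<^sup>2 \<le> (cmod a + cmod b)\<^sup>2"
        by (simp add: norm_triangle_ineq power_mono)
      also have "\<dots> \<le> 2 * ((cmod a)\<^sup>2 + (cmod b)\<^sup>2)"
        using sum_squares_bound[of "cmod a" "cmod b"] by (simp add: power2_sum)
      finally show ?thesis .
    qed
    then show "AE x in M. norm ((cmod (f x + g x))\<^sup>2) \<le> norm (2 * ((cmod (f x))\<^sup>2 + (cmod (g x))\<^sup>2))"
      by simp
  qed
  then show ?thesis
    using f g by (auto simp: L2_space_def)
qed

lemma L2_space_diff:
  assumes "f \<in> L2_space M" "g \<in> L2_space M"
  shows "(\<lambda>x. f x - g x) \<in> L2_space M"
  using L2_space_add[OF assms(1) L2_space_cmult[OF assms(2), of "-1"]] by simp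

lemma L2_space_bounded_mult:
  assumes f: "f \<in> L2_space M" and [measurable]: "u \<in> borel_measurable M"
    and bound: "\<And>x. cmod (u x) \<le> c"
  shows "(\<lambda>x. u x * f x) \<in> L2_space M"
proof -
  have "integrable M (\<lambda>x. (cmod (u x * f x))\<^sup>2)"
  proof (rule Bochner_Integration.integrable_bound)
    show "integrable M (\<lambda>x. c\<^sup>2 * (cmod (f x))\<^sup>2)"
      using f by (intro Bochner_Integration.integrable_mult_right L2_space_integrable)
    note [measurable] = L2_space_measurable[OF f]
    show "(\<lambda>x. (cmod (u x * f x))\<^sup>2) \<in> borel_measurable M"
      by measurable
    show "AE x in M. norm ((cmod (u x * f x))\<^sup>2) \<le> norm (c\<^sup>2 * (cmod (f x))\<^sup>2)"
      by (auto simp: norm_mult power_mult_distrib intro!: mult_right_mono power_mono bound)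
  qed
  then show ?thesis
    using f by (auto simp: L2_space_def)
qed

section \<open>Inner product, norm and the Cauchy-Schwarz inequality\<close>

lemma L2_inner_add_left:
  "f \<in> L2_space M \<Longrightarrow> g \<in> L2_space M \<Longrightarrow> k \<in> L2_space M \<Longrightarrow>
    L2_inner M (\<lambda>x. f x + g x) k = L2_inner M f k + L2_inner M g k"
  by (simp add: L2_inner_def distrib_right L2_inner_integrable)

lemma L2_inner_diff_left:
  "f \<in> L2_space M \<Longrightarrow> g \<in> L2_space M \<Longrightarrow> k \<in> L2_space M \<Longrightarrow>
    L2_inner M (\<lambda>x. f x - g x) k = L2_inner M f k - L2_inner M g k"
  by (simp add: L2_inner_def left_diff_distrib L2_inner_integrable)

lemma L2_inner_diff_right:
  "f \<in> L2_space M \<Longrightarrow> g \<in> L2_space M \<Longrightarrow> k \<in> L2_space M \<Longrightarrow>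
    L2_inner M k (\<lambda>x. f x - g x) = L2_inner M k f - L2_inner M k g"
  by (simp add: L2_inner_def right_diff_distrib L2_inner_integrable)

lemma L2_inner_cmult_left: "L2_inner M (\<lambda>x. c * f x) k = c * L2_inner M f k"
  by (simp add: L2_inner_def mult.assoc)

lemma L2_norm_nonneg: "0 \<le> L2_norm M f"
  by (simp add: L2_norm_def)

lemma L2_norm_power2: "(L2_norm M f)\<^sup>2 = (LINT x|M. (cmod (f x))\<^sup>2)"
  by (simp add: L2_norm_def)

lemma L2_inner_self: "L2_inner M f f = complex_of_real ((L2_norm M f)\<^sup>2)"
  unfolding L2_inner_def L2_norm_power2 integral_complex_of_real[symmetric]
  by (simp only: complex_norm_square)

lemma L2_norm_cmult: "L2_norm M (\<lambda>x. c * f x) = cmod c * L2_norm M f"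
  by (simp add: L2_norm_def norm_mult power_mult_distrib real_sqrt_mult)

text \<open>Expanding in a real parameter gives real quadratics to which the discriminant lemma
  applies; \<open>s = 1\<close> and \<open>s = -1\<close> together give the parallelogram
  law.\<close>

lemma L2_norm_add_power2:
  fixes s :: real and f g :: "'a \<Rightarrow> complex"
  assumes f: "f \<in> L2_space M" and g: "g \<in> L2_space M"
  shows "(L2_norm M (\<lambda>x. f x + s * g x))\<^sup>2
    = (L2_norm M f)\<^sup>2 + 2 * s * Re (L2_inner M f g) + s\<^sup>2 * (L2_norm M g)\<^sup>2"
proof -
  have Re_int: "integrable M (\<lambda>x. Re (f x * cnj (g x)))"
    by (rule integrable_Re[OF L2_inner_integrable[OF f g]])
  have "(L2_norm M (\<lambda>x. f x + s * g x))\<^sup>2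
      = (LINT x|M. (cmod (f x))\<^sup>2 + 2 * s * Re (f x * cnj (g x)) + s\<^sup>2 * (cmod (g x))\<^sup>2)"
    unfolding L2_norm_power2
    by (intro Bochner_Integration.integral_cong refl)
       (simp only: cmod_power2, simp add: power2_eq_square algebra_simps)
  also have "\<dots> = (LINT x|M. (cmod (f x))\<^sup>2) + 2 * s * (LINT x|M. Re (f x * cnj (g x)))
      + s\<^sup>2 * (LINT x|M. (cmod (g x))\<^sup>2)"
    using L2_space_integrable[OF f] L2_space_integrable[OF g] Re_int
    by (simp del: times_complex.simps cnj.simps)
  also have "(LINT x|M. Re (f x * cnj (g x))) = Re (L2_inner M f g)"
    unfolding L2_inner_def by (rule integral_Re[OF L2_inner_integrable[OF f g]])
  finally show ?thesis by (simp add: L2_norm_power2)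
qed

text \<open>Multiplying \<open>f\<close> by a unimodular \<open>u\<close> makes the inner product
  real and nonnegative. The squared norm of \<open>u f + s g\<close> is then a nonnegative quadratic
  in the real \<open>s\<close> with the required discriminant.\<close>

lemma L2_Cauchy_Schwarz:
  assumes f: "f \<in> L2_space M" and g: "g \<in> L2_space M"
  shows "cmod (L2_inner M f g) \<le> L2_norm M f * L2_norm M g"
proof (cases "L2_inner M f g = 0")
  case True
  then show ?thesis by (simp add: L2_norm_nonneg)
next
  case False
  define u where "u = cnj (L2_inner M f g) / cmod (L2_inner M f g)"
  have u: "cmod u = 1"
    using False by (simp add: u_def norm_divide)
  have uf: "(\<lambda>x. u * f x) \<in> L2_space M"
    using f by (rule L2_space_cmult)
  have "u * L2_inner M f g = cmod (L2_inner M f g)"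
    using complex_norm_square[of "L2_inner M f g"] False
    by (simp add: u_def power2_eq_square field_simps)
  then have Re_eq: "Re (L2_inner M (\<lambda>x. u * f x) g) = cmod (L2_inner M f g)"
    by (simp add: L2_inner_cmult_left)
  have "(Re (L2_inner M (\<lambda>x. u * f x) g))\<^sup>2 \<le> (L2_norm M (\<lambda>x. u * f x))\<^sup>2 * (L2_norm M g)\<^sup>2"
  proof (rule quadratic_nonneg_imp_discriminant)
    show "0 \<le> (L2_norm M (\<lambda>x. u * f x))\<^sup>2 + 2 * s * Re (L2_inner M (\<lambda>x. u * f x) g)
        + s\<^sup>2 * (L2_norm M g)\<^sup>2" for s
      unfolding L2_norm_add_power2[OF uf g, symmetric] by simp
  qed simp
  then have "(cmod (L2_inner M f g))\<^sup>2 \<le> (L2_norm M f * L2_norm M g)\<^sup>2"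
    by (simp only: Re_eq L2_norm_cmult u power_mult_distrib) simp
  then show ?thesis
    by (rule power2_le_imp_le) (simp add: L2_norm_nonneg)
qed

lemma L2_norm_bounded_mult:
  assumes f: "f \<in> L2_space M" and [measurable]: "u \<in> borel_measurable M"
    and bound: "\<And>x. cmod (u x) \<le> c"
  shows "L2_norm M (\<lambda>x. u x * f x) \<le> c * L2_norm M f"
proof (rule power2_le_imp_le)
  have "0 \<le> c" using bound norm_ge_zero order_trans by blast
  then show "0 \<le> c * L2_norm M f" by (simp add: L2_norm_nonneg)
  have "(L2_norm M (\<lambda>x. u x * f x))\<^sup>2 \<le> (LINT x|M. c\<^sup>2 * (cmod (f x))\<^sup>2)"
    unfolding L2_norm_power2
  proof (rule integral_mono)
    show "integrable M (\<lambda>x. (cmod (u x * f x))\<^sup>2)"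
      by (rule L2_space_integrable[OF L2_space_bounded_mult[OF f _ bound]]) measurable
    show "integrable M (\<lambda>x. c\<^sup>2 * (cmod (f x))\<^sup>2)"
      by (intro integrable_mult_right L2_space_integrable f)
    show "(cmod (u x * f x))\<^sup>2 \<le> c\<^sup>2 * (cmod (f x))\<^sup>2" for x
      by (auto simp: norm_mult power_mult_distrib intro!: mult_right_mono power_mono bound)
  qed
  then show "(L2_norm M (\<lambda>x. u x * f x))\<^sup>2 \<le> (c * L2_norm M f)\<^sup>2"
    by (simp add: L2_norm_power2 power_mult_distrib)
qed

lemma L2_norm_triangle:
  assumes f: "f \<in> L2_space M" and g: "g \<in> L2_space M"
  shows "L2_norm M (\<lambda>x. f x + g x) \<le> L2_norm M f + L2_norm M g"
proof (rule power2_le_imp_le)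
  have "Re (L2_inner M f g) \<le> L2_norm M f * L2_norm M g"
    using complex_Re_le_cmod L2_Cauchy_Schwarz[OF f g] by (rule order_trans)
  then show "(L2_norm M (\<lambda>x. f x + g x))\<^sup>2 \<le> (L2_norm M f + L2_norm M g)\<^sup>2"
    using L2_norm_add_power2[OF f g, of 1] by (simp add: power2_sum)
qed (simp add: L2_norm_nonneg)

section \<open>Completeness, Riesz representation and adjoints\<close>

lemma nn_integral_L2_norm:
  assumes "f \<in> L2_space M"
  shows "(\<integral>\<^sup>+x. ennreal ((cmod (f x))\<^sup>2) \<partial>M) = ennreal ((L2_norm M f)\<^sup>2)"
  unfolding L2_norm_power2
  by (rule nn_integral_eq_integral[OF L2_space_integrable[OF assms]]) simp

text \<open>The extended nonnegative integral yields membership and the norm bound together.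
  Membership cannot be read off \<open>L2_norm\<close>, whose Bochner integral defaults to 0 outside
  its domain.\<close>

lemma L2_spaceI_nn_integral:
  assumes [measurable]: "f \<in> borel_measurable M"
    and le: "(\<integral>\<^sup>+x. ennreal ((cmod (f x))\<^sup>2) \<partial>M) \<le> ennreal (c\<^sup>2)" and "0 \<le> c"
  shows "f \<in> L2_space M" and "L2_norm M f \<le> c"
proof -
  have "integrable M (\<lambda>x. (cmod (f x))\<^sup>2)"
    using le by (intro integrableI_nonneg) (auto simp: le_less_trans[OF _ ennreal_less_top])
  then show f: "f \<in> L2_space M"
    by (simp add: L2_space_def)
  have "(L2_norm M f)\<^sup>2 \<le> c\<^sup>2"
    using le unfolding nn_integral_L2_norm[OF f] by (simp add: ennreal_le_iff)
  then show "L2_norm M f \<le> c"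
    using \<open>0 \<le> c\<close> by (rule power2_le_imp_le)
qed

text \<open>Riesz-Fischer in quantitative form. The weighted squared increments have an integrable
  sum, so the sequence converges almost everywhere, and Fatou's lemma carries the rate over to the
  limit.\<close>

lemma L2_geometric_Cauchy_converges:
  fixes F :: "nat \<Rightarrow> 'a \<Rightarrow> complex"
  assumes F: "\<And>n. F n \<in> L2_space M" and "0 \<le> C"
    and Cauchy: "\<And>n k. n \<le> k \<Longrightarrow> L2_norm M (\<lambda>x. F n x - F k x) \<le> C * (1/2) ^ n"
  shows "\<exists>G \<in> L2_space M. \<forall>n. L2_norm M (\<lambda>x. F n x - G x) \<le> C * (1/2) ^ n"
proof -
  note [measurable] = L2_space_measurable[OF F]
  have diff_L2: "(\<lambda>x. F n x - F k x) \<in> L2_space M" for n k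
    by (intro L2_space_diff F)
  have diff_nn: "(\<integral>\<^sup>+x. ennreal ((cmod (F n x - F k x))\<^sup>2) \<partial>M) \<le> ennreal ((C * (1/2) ^ n)\<^sup>2)"
    if "n \<le> k" for n k
    unfolding nn_integral_L2_norm[OF diff_L2]
    by (intro ennreal_leI power_mono Cauchy that L2_norm_nonneg)
  \<comment> \<open>The squared norms of the increments are at most
    \<open>C\<^sup>2 * (1/4) ^ n\<close>, so the weight \<open>2 ^ n\<close> still leaves a summable
    series, while finiteness of the sum at a point forces the increments there to decay with ratio
    \<open>1 / sqrt 2\<close>.\<close>
  let ?d = "\<lambda>n x. 2 ^ n * (cmod (F n x - F (Suc n) x))\<^sup>2"
  have "(\<integral>\<^sup>+x. (\<Sum>n. ennreal (?d n x)) \<partial>M) = (\<Sum>n. \<integral>\<^sup>+x. ennreal (?d n x) \<partial>M)"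
    by (rule nn_integral_suminf) measurable
  also have "\<dots> \<le> (\<Sum>n. ennreal (C\<^sup>2 * (1/2) ^ n))"
  proof (rule suminf_le)
    fix n
    have "(\<integral>\<^sup>+x. ennreal (?d n x) \<partial>M) = ennreal (2 ^ n) * (\<integral>\<^sup>+x. ennreal ((cmod (F n x - F (Suc n) x))\<^sup>2) \<partial>M)"
      by (subst nn_integral_cmult[symmetric]) (auto simp: ennreal_mult)
    also have "\<dots> \<le> ennreal (2 ^ n) * ennreal ((C * (1/2) ^ n)\<^sup>2)"
      by (intro mult_left_mono diff_nn) auto
    also have "\<dots> = ennreal (2 ^ n * (C * (1/2) ^ n)\<^sup>2)"
      by (rule ennreal_mult[symmetric]) auto
    also have "2 ^ n * (C * (1/2) ^ n)\<^sup>2 = C\<^sup>2 * (1/2) ^ n"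
      by (simp add: power2_eq_square field_simps)
    finally show "(\<integral>\<^sup>+x. ennreal (?d n x) \<partial>M) \<le> ennreal (C\<^sup>2 * (1/2) ^ n)" .
  qed auto
  also have "\<dots> = ennreal (\<Sum>n. C\<^sup>2 * (1/2) ^ n)"
    by (intro suminf_ennreal2 summable_mult summable_geometric) auto
  also have "\<dots> < \<top>" by simp
  finally have "(\<integral>\<^sup>+x. (\<Sum>n. ennreal (?d n x)) \<partial>M) \<noteq> \<infinity>"
    by simp
  then have "AE x in M. (\<Sum>n. ennreal (?d n x)) \<noteq> \<infinity>"
    by (rule nn_integral_PInf_AE[rotated]) measurable
  then have conv: "AE x in M. convergent (\<lambda>n. F n x)"
  proof eventually_elim
    fix x assume fin: "(\<Sum>n. ennreal (?d n x)) \<noteq> \<infinity>"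
    define K where "K = enn2real (\<Sum>n. ennreal (?d n x))"
    have dK: "?d n x \<le> K" for n
    proof -
      have "f n \<le> suminf f" for f :: "nat \<Rightarrow> ennreal"
        using sum_le_suminf[of f "{n}"] by simp
      then have "ennreal (?d n x) \<le> (\<Sum>n. ennreal (?d n x))" .
      also have "\<dots> = ennreal K"
        using fin by (simp add: K_def)
      finally show ?thesis
        by (simp add: K_def ennreal_le_iff)
    qed
    have bound: "cmod (F (Suc n) x - F n x) \<le> sqrt K * (1 / sqrt 2) ^ n" for n
    proof -
      have "(cmod (F n x - F (Suc n) x))\<^sup>2 \<le> K / 2 ^ n"
        using dK[of n] by (simp add: field_simps)
      then have "cmod (F n x - F (Suc n) x) \<le> sqrt (K / 2 ^ n)"
        by (rule real_le_rsqrt)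
      then show ?thesis
        by (simp add: real_sqrt_mult real_sqrt_inverse real_sqrt_power norm_minus_commute
            divide_inverse power_inverse)
    qed
    have "summable (\<lambda>n. F (Suc n) x - F n x)"
      by (rule summable_comparison_test'[where N = 0, OF summable_mult[OF summable_geometric] bound])
         simp
    then have "convergent (\<lambda>n. \<Sum>i<n. F (Suc i) x - F i x)"
      by (simp add: summable_iff_convergent)
    then have "convergent (\<lambda>n. F n x - F 0 x)"
      using sum_lessThan_telescope[of "\<lambda>n. F n x"] by simp
    then show "convergent (\<lambda>n. F n x)"
      using convergent_add_const_right_iff[of "\<lambda>n. F n x" "- F 0 x"] by simp
  qed
  \<comment> \<open>Where the sequence diverges, \<open>lim\<close> has an unspecified value; this
    concerns only a null set.\<close>
  define G where "G x = lim (\<lambda>n. F n x)" for x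
  have [measurable]: "G \<in> borel_measurable M"
    unfolding G_def by measurable
  have lim_G: "AE x in M. (\<lambda>k. F k x) \<longlonglongrightarrow> G x"
    using conv by eventually_elim (simp add: G_def convergent_LIMSEQ_iff)
  \<comment> \<open>Fatou in \<open>k\<close> with \<open>n\<close> fixed; for \<open>k\<close> at
    least \<open>n\<close> the Cauchy hypothesis bounds the integrals.\<close>
  have FG: "(\<integral>\<^sup>+x. ennreal ((cmod (F n x - G x))\<^sup>2) \<partial>M) \<le> ennreal ((C * (1/2) ^ n)\<^sup>2)" for n
  proof -
    have "(\<integral>\<^sup>+x. ennreal ((cmod (F n x - G x))\<^sup>2) \<partial>M)
        = (\<integral>\<^sup>+x. liminf (\<lambda>k. ennreal ((cmod (F n x - F k x))\<^sup>2)) \<partial>M)"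
      using lim_G
      by (intro nn_integral_cong_AE, eventually_elim)
         (auto intro!: lim_imp_Liminf[symmetric] tendsto_intros)
    also have "\<dots> \<le> liminf (\<lambda>k. \<integral>\<^sup>+x. ennreal ((cmod (F n x - F k x))\<^sup>2) \<partial>M)"
      by (rule nn_integral_liminf) measurable
    also have "\<dots> \<le> ennreal ((C * (1/2) ^ n)\<^sup>2)"
      by (intro Liminf_le) (auto simp: eventually_sequentially intro!: exI[of _ n] diff_nn)
    finally show ?thesis .
  qed
  have FG_L2: "(\<lambda>x. F n x - G x) \<in> L2_space M" and FG_norm: "L2_norm M (\<lambda>x. F n x - G x) \<le> C * (1/2) ^ n" for n
    using L2_spaceI_nn_integral[OF _ FG] \<open>0 \<le> C\<close> by auto
  have "G \<in> L2_space M"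
    using L2_space_diff[OF F[of 0] FG_L2[of 0]] by simp
  then show ?thesis
    using FG_norm by blast
qed

text \<open>Direct method: the representative is the limit of a minimising sequence for
  \<open>J\<close>, the squared norm minus twice the real part of the functional. Boundedness of the
  functional keeps \<open>J\<close> bounded below, and the first variation in each direction
  identifies the real part of the functional.\<close>

lemma L2_Riesz:
  fixes \<Lambda> :: "('a \<Rightarrow> complex) \<Rightarrow> complex"
  assumes add: "\<And>f g. f \<in> L2_space M \<Longrightarrow> g \<in> L2_space M \<Longrightarrow> \<Lambda> (\<lambda>x. f x + g x) = \<Lambda> f + \<Lambda> g"
    and cmult: "\<And>c f. f \<in> L2_space M \<Longrightarrow> \<Lambda> (\<lambda>x. c * f x) = c * \<Lambda> f"
    and bounded: "\<And>f. f \<in> L2_space M \<Longrightarrow> cmod (\<Lambda> f) \<le> B * L2_norm M f"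
  shows "\<exists>G \<in> L2_space M. \<forall>f \<in> L2_space M. \<Lambda> f = L2_inner M f G"
proof -
  define J where "J f = (L2_norm M f)\<^sup>2 - 2 * Re (\<Lambda> f)" for f
  define j where "j = Inf (J ` L2_space M)"
  have zero: "(\<lambda>x. 0) \<in> L2_space M"
    by (simp add: L2_space_def)
  have J_lower: "- B\<^sup>2 \<le> J f" if "f \<in> L2_space M" for f
  proof -
    have "Re (\<Lambda> f) \<le> B * L2_norm M f"
      using bounded[OF that] complex_Re_le_cmod[of "\<Lambda> f"] by linarith
    moreover have "0 \<le> (L2_norm M f - B)\<^sup>2"
      by simp
    ultimately show ?thesis
      by (simp add: J_def power2_diff algebra_simps)
  qed
  have bdd: "bdd_below (J ` L2_space M)"
    using J_lower by (auto simp: bdd_below_def)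
  have j_le: "j \<le> J f" if "f \<in> L2_space M" for f
    unfolding j_def using that bdd by (intro cInf_lower) auto
  \<comment> \<open>Distances are square roots of the excess of \<open>J\<close>, so an excess of
    \<open>(1/4) ^ n\<close> gives the rate \<open>(1/2) ^ n\<close> that the completeness lemma
    expects.\<close>
  have "\<exists>f \<in> L2_space M. J f < j + (1/4) ^ n" for n :: nat
    using cInf_lessD[of "J ` L2_space M" "j + (1/4) ^ n"] zero unfolding j_def by auto
  then obtain F where F: "\<And>n. F n \<in> L2_space M" and JF: "\<And>n :: nat. J (F n) < j + (1/4) ^ n"
    by metis
  have J_add: "J (\<lambda>x. f x + of_real s * g x)
      = J f + 2 * s * (Re (L2_inner M f g) - Re (\<Lambda> g)) + s\<^sup>2 * (L2_norm M g)\<^sup>2"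
    if "f \<in> L2_space M" "g \<in> L2_space M" for f g and s :: real
    using that by (simp add: J_def L2_norm_add_power2 add cmult L2_space_cmult algebra_simps)
  \<comment> \<open>The parallelogram law makes the minimizing sequence Cauchy.\<close>
  have Cauchy: "L2_norm M (\<lambda>x. F n x - F k x) \<le> 2 * (1/2) ^ n" if "n \<le> k" for n k
  proof -
    have "J (\<lambda>x. (1/2) * (F n x + of_real 1 * F k x))
        = (J (F n) + J (F k)) / 2 - (L2_norm M (\<lambda>x. F n x + of_real (-1) * F k x))\<^sup>2 / 4"
    proof -
      let ?S = "\<lambda>x. F n x + of_real 1 * F k x"
      have S: "?S \<in> L2_space M"
        by (intro L2_space_add L2_space_cmult F)
      have "J (\<lambda>x. (1/2) * ?S x) = (L2_norm M ?S)\<^sup>2 / 4 - Re (\<Lambda> ?S)"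
        unfolding J_def L2_norm_cmult cmult[OF S] by (simp add: power_divide)
      moreover have "\<Lambda> ?S = \<Lambda> (F n) + \<Lambda> (F k)"
        using add[OF F F] by simp
      ultimately show ?thesis
        by (simp only: J_def L2_norm_add_power2[OF F F]) (simp add: field_simps)
    qed
    moreover have "j \<le> J (\<lambda>x. (1/2) * (F n x + of_real 1 * F k x))"
      by (intro j_le L2_space_cmult L2_space_add F)
    moreover have "D \<le> 2 * (a + b)"
      if "m = (y + z) / 2 - D / 4" "j \<le> m" "y < j + a" "z < j + b" for m y z D a b :: real
      using that by (simp add: field_simps)
    ultimately have "(L2_norm M (\<lambda>x. F n x + of_real (-1) * F k x))\<^sup>2
        \<le> 2 * ((1/4) ^ n + (1/4) ^ k)"
      using JF[of n] JF[of k] by blast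
    then have "(L2_norm M (\<lambda>x. F n x - F k x))\<^sup>2 \<le> 2 * ((1/4) ^ n + (1/4) ^ k)"
      by simp
    also have "\<dots> \<le> 4 * (1/4) ^ n"
      using power_decreasing[OF that, of "1/4::real"] by simp
    also have "\<dots> = (2 * (1/2) ^ n)\<^sup>2"
      by (simp add: power2_eq_square power_mult_distrib[symmetric])
    finally show ?thesis
      by (rule power2_le_imp_le) simp
  qed
  from L2_geometric_Cauchy_converges[OF F _ Cauchy]
  obtain G where G: "G \<in> L2_space M" and FG: "\<And>n. L2_norm M (\<lambda>x. F n x - G x) \<le> 2 * (1/2) ^ n"
    by auto
  \<comment> \<open>The first variation is taken at \<open>F n\<close>, where the excess of
    \<open>J\<close> is below \<open>(1/4) ^ n\<close>; the discriminant bounds the defect by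
    \<open>(1/2) ^ n * L2_norm M g\<close>. Passing from \<open>F n\<close> to \<open>G\<close>
    costs twice that, hence the factor 3.\<close>
  have Re_eq: "Re (\<Lambda> g) = Re (L2_inner M G g)" if g: "g \<in> L2_space M" for g
  proof -
    have bound: "\<bar>Re (L2_inner M G g) - Re (\<Lambda> g)\<bar> \<le> (3 * L2_norm M g) * (1/2) ^ n" for n
    proof -
      have "(Re (L2_inner M (F n) g) - Re (\<Lambda> g))\<^sup>2 \<le> (1/4) ^ n * (L2_norm M g)\<^sup>2"
      proof (rule quadratic_nonneg_imp_discriminant)
        fix s :: real
        have "j \<le> J (\<lambda>x. F n x + of_real s * g x)"
          by (intro j_le L2_space_cmult L2_space_add F g)
        then show "0 \<le> (1/4) ^ n + 2 * s * (Re (L2_inner M (F n) g) - Re (\<Lambda> g)) + s\<^sup>2 * (L2_norm M g)\<^sup>2"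
          using JF[of n] unfolding J_add[OF F g] by linarith
      qed simp
      also have "\<dots> = ((1/2) ^ n * L2_norm M g)\<^sup>2"
        by (simp add: power_mult_distrib power2_eq_square)
           (simp add: power_mult_distrib[symmetric])
      finally have "\<bar>Re (L2_inner M (F n) g) - Re (\<Lambda> g)\<bar> \<le> (1/2) ^ n * L2_norm M g"
        using abs_le_square_iff[of "Re (L2_inner M (F n) g) - Re (\<Lambda> g)" "(1/2) ^ n * L2_norm M g"]
        by (simp add: L2_norm_nonneg)
      moreover have "\<bar>Re (L2_inner M (F n) g) - Re (L2_inner M G g)\<bar> \<le> 2 * (1/2) ^ n * L2_norm M g"
      proof -
        have "\<bar>Re (L2_inner M (F n) g) - Re (L2_inner M G g)\<bar> \<le> cmod (L2_inner M (\<lambda>x. F n x - G x) g)"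
          using abs_Re_le_cmod[of "L2_inner M (F n) g - L2_inner M G g"]
          by (simp add: L2_inner_diff_left F G g)
        also have "\<dots> \<le> L2_norm M (\<lambda>x. F n x - G x) * L2_norm M g"
          by (intro L2_Cauchy_Schwarz L2_space_diff F G g)
        also have "\<dots> \<le> 2 * (1/2) ^ n * L2_norm M g"
          by (intro mult_right_mono FG L2_norm_nonneg)
        finally show ?thesis .
      qed
      ultimately show ?thesis by (simp add: algebra_simps)
    qed
    have "(\<lambda>n. (3 * L2_norm M g) * (1/2) ^ n) \<longlonglongrightarrow> (3 * L2_norm M g) * 0"
      by (intro tendsto_mult tendsto_const LIMSEQ_power_zero) simp
    from LIMSEQ_le_const[OF this, of "\<bar>Re (L2_inner M G g) - Re (\<Lambda> g)\<bar>"] bound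
    show ?thesis by simp
  qed
  have inner_swap: "Re (L2_inner M G g) = Re (L2_inner M g G)" if "g \<in> L2_space M" for g
    unfolding L2_inner_def
    by (subst (1 2) integral_Re[symmetric]) (auto intro!: L2_inner_integrable G that simp: mult.commute)
  have "\<Lambda> f = L2_inner M f G" if f: "f \<in> L2_space M" for f
  proof (rule complex_eqI)
    show "Re (\<Lambda> f) = Re (L2_inner M f G)"
      using f by (simp add: Re_eq inner_swap)
    \<comment> \<open>Multiplying by minus the imaginary unit turns imaginary parts into real
      parts.\<close>
    have "Re (\<Lambda> (\<lambda>x. - \<i> * f x)) = Re (L2_inner M (\<lambda>x. - \<i> * f x) G)"
      using L2_space_cmult[OF f, of "- \<i>"] by (simp only: Re_eq inner_swap)
    then show "Im (\<Lambda> f) = Im (L2_inner M f G)"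
      unfolding cmult[OF f] L2_inner_cmult_left by simp
  qed
  then show ?thesis using G by blast
qed

text \<open>The functional sending \<open>f\<close> to the inner product of \<open>T f\<close> with
  \<open>F\<close> is bounded by Cauchy-Schwarz, so Riesz supplies a witness; only then does the
  \<open>SOME\<close> in \<open>L2_adjoint\<close> carry information.\<close>

lemma L2_adjoint_exists:
  assumes T: "\<And>f. f \<in> L2_space M \<Longrightarrow> T f \<in> L2_space N"
    and add: "\<And>f g. f \<in> L2_space M \<Longrightarrow> g \<in> L2_space M \<Longrightarrow> T (\<lambda>x. f x + g x) = (\<lambda>y. T f y + T g y)"
    and cmult: "\<And>c f. f \<in> L2_space M \<Longrightarrow> T (\<lambda>x. c * f x) = (\<lambda>y. c * T f y)"
    and bounded: "\<And>f. f \<in> L2_space M \<Longrightarrow> L2_norm N (T f) \<le> B * L2_norm M f"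
    and F: "F \<in> L2_space N"
  shows "L2_adjoint M N T F \<in> L2_space M"
    and "f \<in> L2_space M \<Longrightarrow> L2_inner N (T f) F = L2_inner M f (L2_adjoint M N T F)"
proof -
  have "\<exists>G \<in> L2_space M. \<forall>f \<in> L2_space M. L2_inner N (T f) F = L2_inner M f G"
  proof (rule L2_Riesz)
    fix f assume f: "f \<in> L2_space M"
    have "cmod (L2_inner N (T f) F) \<le> L2_norm N (T f) * L2_norm N F"
      by (rule L2_Cauchy_Schwarz[OF T[OF f] F])
    also have "\<dots> \<le> B * L2_norm M f * L2_norm N F"
      by (intro mult_right_mono bounded f L2_norm_nonneg)
    finally show "cmod (L2_inner N (T f) F) \<le> (B * L2_norm N F) * L2_norm M f"
      by (simp add: mult.commute mult.left_commute)
  qed (simp_all add: add cmult L2_inner_add_left L2_inner_cmult_left T F)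
  then have "\<exists>G. G \<in> L2_space M \<and> (\<forall>f \<in> L2_space M. L2_inner N (T f) F = L2_inner M f G)"
    by blast
  from someI_ex[OF this, folded L2_adjoint_def]
  show "L2_adjoint M N T F \<in> L2_space M"
    and "f \<in> L2_space M \<Longrightarrow> L2_inner N (T f) F = L2_inner M f (L2_adjoint M N T F)"
    by auto
qed

text \<open>Duality by self-testing: \<open>D\<close> stands for an adjoint value at
  \<open>F\<close>, or a difference of two, and \<open>V\<close> for the transform of
  \<open>D\<close>. Cauchy-Schwarz bounds the squared norm of \<open>D\<close> by \<open>b\<close>
  times its norm times the norm of \<open>F\<close>, and one factor cancels.\<close>

lemma L2_norm_le_dual:
  assumes D: "D \<in> L2_space M" and V: "V \<in> L2_space N" and F: "F \<in> L2_space N"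
    and eq: "L2_inner M D D = L2_inner N V F" and le: "L2_norm N V \<le> b * L2_norm M D"
    and "0 \<le> b"
  shows "L2_norm M D \<le> b * L2_norm N F"
proof (cases "L2_norm M D = 0")
  case True
  then show ?thesis using \<open>0 \<le> b\<close> by (simp add: L2_norm_nonneg)
next
  case False
  have "(L2_norm M D)\<^sup>2 = cmod (L2_inner M D D)"
    by (simp add: L2_inner_self norm_power)
  also have "\<dots> \<le> L2_norm N V * L2_norm N F"
    unfolding eq by (rule L2_Cauchy_Schwarz[OF V F])
  also have "\<dots> \<le> b * L2_norm M D * L2_norm N F"
    by (intro mult_right_mono le L2_norm_nonneg)
  finally have "L2_norm M D * L2_norm M D \<le> L2_norm M D * (b * L2_norm N F)"
    by (simp add: power2_eq_square mult_ac)
  then show ?thesis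
    using False L2_norm_nonneg[of M D] by (simp add: mult_le_cancel_left)
qed

section \<open>Bessel's inequality for the Fourier transform\<close>

definition wave :: "real \<Rightarrow> real \<Rightarrow> complex" where
  "wave \<omega> x = exp (2 * \<i> * complex_of_real pi * complex_of_real \<omega> * complex_of_real x)"

lemma wave_eq_cis: "wave \<omega> x = cis (2 * pi * \<omega> * x)"
  by (simp add: wave_def cis_conv_exp mult_ac)

lemma norm_wave [simp]: "cmod (wave \<omega> x) = 1"
  by (simp add: wave_eq_cis)

lemma wave_measurable [measurable]: "(\<lambda>(\<omega>, x). wave \<omega> x) \<in> borel_measurable (borel \<Otimes>\<^sub>M borel)"
  unfolding wave_def by measurable

lemma cnj_wave_mult_wave: "cnj (wave \<omega> x) * wave \<omega> y = wave \<omega> (y - x)"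
  by (simp add: wave_eq_cis cis_cnj cis_mult algebra_simps)

text \<open>Read off from the characteristic function of the standard normal distribution by
  rescaling with \<open>r\<close>. That the result is a probability density is what keeps the
  constant 1 in Bessel's inequality.\<close>

lemma gaussian_transform:
  fixes r x :: real
  assumes "0 < r"
  shows "(LINT \<omega>|lborel. complex_of_real (exp (- \<omega>\<^sup>2 / (2 * r\<^sup>2))) * wave \<omega> x)
    = complex_of_real (normal_density 0 (1 / (2 * pi * r)) x)"
proof -
  have "complex_of_real (exp (- (2 * pi * r * x)\<^sup>2 / 2)) = char std_normal_distribution (2 * pi * r * x)"
    by (simp add: char_std_normal_distribution)
  also have "\<dots> = (LINT z|lborel. std_normal_density z *\<^sub>R iexp (2 * pi * r * x * z))"
    unfolding char_def by (subst integral_density) (auto simp: normal_density_nonneg)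
  also have "\<dots> = (1 / r) *\<^sub>R (LINT \<omega>|lborel. std_normal_density (\<omega> / r) *\<^sub>R iexp (2 * pi * r * x * (\<omega> / r)))"
    using assms by (subst lborel_integral_real_affine[where c = "1 / r" and t = 0]) auto
  also have "(LINT \<omega>|lborel. std_normal_density (\<omega> / r) *\<^sub>R iexp (2 * pi * r * x * (\<omega> / r)))
      = (LINT \<omega>|lborel. complex_of_real (1 / sqrt (2 * pi)) *
          (complex_of_real (exp (- \<omega>\<^sup>2 / (2 * r\<^sup>2))) * wave \<omega> x))"
    using assms
    by (intro Bochner_Integration.integral_cong refl)
       (simp add: wave_def std_normal_density_def scaleR_conv_of_real power_divide mult_ac)
  finally have "complex_of_real (exp (- (2 * pi * r * x)\<^sup>2 / 2))
      = complex_of_real (1 / (r * sqrt (2 * pi))) *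
        (LINT \<omega>|lborel. complex_of_real (exp (- \<omega>\<^sup>2 / (2 * r\<^sup>2))) * wave \<omega> x)"
    by (simp add: scaleR_conv_of_real)
  then have "(LINT \<omega>|lborel. complex_of_real (exp (- \<omega>\<^sup>2 / (2 * r\<^sup>2))) * wave \<omega> x)
      = complex_of_real (r * sqrt (2 * pi) * exp (- (2 * pi * r * x)\<^sup>2 / 2))"
    using assms by (simp add: field_simps)
  also have "r * sqrt (2 * pi) * exp (- (2 * pi * r * x)\<^sup>2 / 2) = normal_density 0 (1 / (2 * pi * r)) x"
  proof -
    have "1 / sqrt (2 * pi * (1 / (2 * pi * r))\<^sup>2) = r * sqrt (2 * pi)"
      using assms by (simp add: real_sqrt_mult real_sqrt_divide power_divide field_simps)
    moreover have "- (x - 0)\<^sup>2 / (2 * (1 / (2 * pi * r))\<^sup>2) = - (2 * pi * r * x)\<^sup>2 / 2"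
      using assms by (simp add: power_divide power_mult_distrib field_simps)
    ultimately show ?thesis by (simp add: normal_density_def)
  qed
  finally show ?thesis .
qed

text \<open>Since the kernel has modulus at most one, the integrable product of \<open>u\<close> and
  \<open>v\<close> dominates the integrand on the plane, and Fubini applies.\<close>

lemma integral_swap_bounded_kernel:
  fixes u v :: "real \<Rightarrow> complex" and k :: "real \<Rightarrow> real \<Rightarrow> complex"
  assumes u: "integrable lborel u" and v: "integrable lborel v"
    and [measurable]: "(\<lambda>(\<omega>, x). k \<omega> x) \<in> borel_measurable (borel \<Otimes>\<^sub>M borel)"
    and k: "\<And>\<omega> x. cmod (k \<omega> x) \<le> 1"
  shows "(LINT \<omega>|lborel. u \<omega> * (LINT x|lborel. v x * k \<omega> x))
    = (LINT x|lborel. v x * (LINT \<omega>|lborel. u \<omega> * k \<omega> x))"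
proof -
  note [measurable] = borel_measurable_integrable[OF u] borel_measurable_integrable[OF v]
  have "integrable (lborel \<Otimes>\<^sub>M lborel) (\<lambda>(\<omega>, x). u \<omega> * v x)"
  proof (rule lborel_pair.Fubini_integrable)
    show "integrable lborel (\<lambda>\<omega>. LINT x|lborel. norm (case (\<omega>, x) of (\<omega>, x) \<Rightarrow> u \<omega> * v x))"
      using u by (auto simp: norm_mult)
    show "AE \<omega> in lborel. integrable lborel (\<lambda>x. case (\<omega>, x) of (\<omega>, x) \<Rightarrow> u \<omega> * v x)"
      using v by simp
  qed measurable
  then have "integrable (lborel \<Otimes>\<^sub>M lborel) (\<lambda>(\<omega>, x). u \<omega> * (v x * k \<omega> x))"
  proof (rule Bochner_Integration.integrable_bound)
    show "AE z in lborel \<Otimes>\<^sub>M lborel. norm (case z of (\<omega>, x) \<Rightarrow> u \<omega> * (v x * k \<omega> x))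
        \<le> norm (case z of (\<omega>, x) \<Rightarrow> u \<omega> * v x)"
      using k by (intro AE_I2) (auto simp: norm_mult intro!: mult_left_mono mult_left_le)
  qed measurable
  from lborel_pair.Fubini_integral[OF this]
  have "(LINT \<omega>|lborel. LINT x|lborel. u \<omega> * (v x * k \<omega> x))
      = (LINT x|lborel. LINT \<omega>|lborel. u \<omega> * (v x * k \<omega> x))"
    by simp
  also have "\<dots> = (LINT x|lborel. LINT \<omega>|lborel. v x * (u \<omega> * k \<omega> x))"
    by (simp only: mult.left_commute)
  finally show ?thesis by simp
qed

text \<open>Weighting the left-hand side by a Gaussian turns it into \<open>\<integral>\<integral> g(x) cnj(g(y)) K(x - y)\<close> for a
  probability density \<open>K\<close>, which AM-GM bounds by the right-hand side; Fatou's lemma removes the weight.\<close>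

lemma Bessel_nn_integral:
  fixes g :: "real \<Rightarrow> complex"
  assumes g: "integrable lborel g"
  shows "(\<integral>\<^sup>+\<omega>. ennreal ((cmod (LINT x|lborel. g x * cnj (wave \<omega> x)))\<^sup>2) \<partial>lborel)
    \<le> (\<integral>\<^sup>+x. ennreal ((cmod (g x))\<^sup>2) \<partial>lborel)"
proof -
  note [measurable] = borel_measurable_integrable[OF g]
  define \<G> where "\<G> \<omega> = (LINT x|lborel. g x * cnj (wave \<omega> x))" for \<omega>
  have [measurable]: "\<G> \<in> borel_measurable borel"
    unfolding \<G>_def by measurable
  \<comment> \<open>A crude uniform bound on the transform by the L1 norm of \<open>g\<close>; it
    makes the Gaussian-weighted integrals below converge absolutely.\<close>
  define B where "B = (LINT x|lborel. cmod (g x))"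
  have \<G>_bound: "cmod (\<G> \<omega>) \<le> B" for \<omega>
    unfolding \<G>_def B_def
    using integral_norm_bound[of lborel "\<lambda>x. g x * cnj (wave \<omega> x)"] by (simp add: norm_mult)
  have cnj_\<G>: "cnj (\<G> \<omega>) = (LINT y|lborel. cnj (g y) * wave \<omega> y)" for \<omega>
    unfolding \<G>_def by (subst Bochner_Integration.integral_cnj[symmetric]) (simp del: Bochner_Integration.integral_cnj)
  define w where "w r \<omega> = exp (- \<omega>\<^sup>2 / (2 * r\<^sup>2))" for r \<omega> :: real
  have [measurable]: "w r \<in> borel_measurable borel" for r
    unfolding w_def by measurable
  have w_int: "integrable lborel (\<lambda>\<omega>. w r \<omega>)" if "0 < r" for r
  proof -
    have "integrable lborel (\<lambda>\<omega>. sqrt (2 * pi * r\<^sup>2) * normal_density 0 r \<omega>)"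
      using that by (intro integrable_mult_right integrable_normal_density)
    moreover have "(\<lambda>\<omega>. sqrt (2 * pi * r\<^sup>2) * normal_density 0 r \<omega>) = w r"
      using that by (auto simp: normal_density_def w_def fun_eq_iff)
    ultimately show ?thesis by simp
  qed
  have w_mult_int: "integrable lborel (\<lambda>\<omega>. complex_of_real (w r \<omega>) * q \<omega>)"
    if "0 < r" "\<And>\<omega>. cmod (q \<omega>) \<le> c" and [measurable]: "q \<in> borel_measurable borel" for r q c
  proof (rule Bochner_Integration.integrable_bound)
    show "integrable lborel (\<lambda>\<omega>. c * w r \<omega>)"
      using w_int[OF that(1)] by simp
    have "0 \<le> c" using that(2)[of 0] norm_ge_zero order_trans by blast
    then show "AE \<omega> in lborel. norm (complex_of_real (w r \<omega>) * q \<omega>) \<le> norm (c * w r \<omega>)"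
      using that(2) by (auto simp: norm_mult w_def mult.commute)
  qed measurable
  have weighted: "(\<integral>\<^sup>+\<omega>. ennreal (w r \<omega> * (cmod (\<G> \<omega>))\<^sup>2) \<partial>lborel)
      \<le> (\<integral>\<^sup>+x. ennreal ((cmod (g x))\<^sup>2) \<partial>lborel)" if r: "0 < r" for r
  proof -
    let ?K = "normal_density 0 (1 / (2 * pi * r))"
    have K_nn: "(\<integral>\<^sup>+y. ennreal (?K (x - y)) \<partial>lborel) = 1" for x
    proof -
      have "(\<integral>\<^sup>+y. ennreal (?K y) \<partial>lborel) = 1"
        using r by (simp add: nn_integral_eq_integral)
      then show ?thesis
        by (subst (asm) nn_integral_real_affine[where c = "-1" and t = x]) auto
    qed
    have K_sym: "?K (x - y) = ?K (y - x)" for x y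
      by (simp add: normal_density_def power2_commute)
    \<comment> \<open>Write the squared modulus as the transform times its conjugate and swap twice:
      the integral over \<open>x\<close> moves outside, then the one over \<open>y\<close>, and the
      frequency integral that remains is a Gaussian transform.\<close>
    have "(LINT \<omega>|lborel. complex_of_real (w r \<omega> * (cmod (\<G> \<omega>))\<^sup>2))
        = (LINT \<omega>|lborel. (complex_of_real (w r \<omega>) * cnj (\<G> \<omega>)) * (LINT x|lborel. g x * cnj (wave \<omega> x)))"
      by (intro Bochner_Integration.integral_cong refl)
         (simp add: \<G>_def[symmetric] complex_norm_square[unfolded of_real_power] mult_ac)
    also have "\<dots> = (LINT x|lborel. g x *
        (LINT \<omega>|lborel. (complex_of_real (w r \<omega>) * cnj (\<G> \<omega>)) * cnj (wave \<omega> x)))"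
      using \<G>_bound by (intro integral_swap_bounded_kernel g w_mult_int[where c = B] r) (auto simp: split_beta')
    also have "\<dots> = (LINT x|lborel. g x * (LINT y|lborel. cnj (g y) * ?K (x - y)))"
    proof (rule Bochner_Integration.integral_cong[OF refl], rule arg_cong2[where f = "(*)", OF refl])
      fix x
      have "(LINT \<omega>|lborel. (complex_of_real (w r \<omega>) * cnj (\<G> \<omega>)) * cnj (wave \<omega> x))
          = (LINT \<omega>|lborel. (complex_of_real (w r \<omega>) * cnj (wave \<omega> x)) * (LINT y|lborel. cnj (g y) * wave \<omega> y))"
        by (simp add: cnj_\<G> mult_ac)
      also have "\<dots> = (LINT y|lborel. cnj (g y) *
          (LINT \<omega>|lborel. (complex_of_real (w r \<omega>) * cnj (wave \<omega> x)) * wave \<omega> y))"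
        using g by (intro integral_swap_bounded_kernel w_mult_int[where c = 1] r) auto
      also have "\<dots> = (LINT y|lborel. cnj (g y) * ?K (x - y))"
      proof (rule Bochner_Integration.integral_cong[OF refl], rule arg_cong2[where f = "(*)", OF refl])
        fix y
        have "(LINT \<omega>|lborel. (complex_of_real (w r \<omega>) * cnj (wave \<omega> x)) * wave \<omega> y)
            = (LINT \<omega>|lborel. complex_of_real (exp (- \<omega>\<^sup>2 / (2 * r\<^sup>2))) * wave \<omega> (y - x))"
          by (simp add: w_def mult.assoc cnj_wave_mult_wave)
        also have "\<dots> = complex_of_real (?K (x - y))"
          by (subst K_sym) (rule gaussian_transform[OF r])
        finally show "(LINT \<omega>|lborel. (complex_of_real (w r \<omega>) * cnj (wave \<omega> x)) * wave \<omega> y)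
            = complex_of_real (?K (x - y))" .
      qed
      finally show "(LINT \<omega>|lborel. (complex_of_real (w r \<omega>) * cnj (\<G> \<omega>)) * cnj (wave \<omega> x))
          = (LINT y|lborel. cnj (g y) * ?K (x - y))" .
    qed
    finally have eq: "complex_of_real (LINT \<omega>|lborel. w r \<omega> * (cmod (\<G> \<omega>))\<^sup>2)
        = (LINT x|lborel. g x * (LINT y|lborel. cnj (g y) * ?K (x - y)))"
      by (simp only: integral_complex_of_real)
    \<comment> \<open>Valid for every \<open>f\<close>: without integrability the Bochner integral
      is 0.\<close>
    have norm_le: "ennreal (cmod (integral\<^sup>L lborel f)) \<le> (\<integral>\<^sup>+x. ennreal (cmod (f x)) \<partial>lborel)"
      for f :: "real \<Rightarrow> complex"
      by (cases "integrable lborel f") (auto simp: not_integrable_integral_eq intro: integral_norm_bound_ennreal)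
    have "integrable lborel (\<lambda>\<omega>. w r \<omega> * (cmod (\<G> \<omega>))\<^sup>2)"
    proof (rule Bochner_Integration.integrable_bound)
      show "integrable lborel (\<lambda>\<omega>. B\<^sup>2 * w r \<omega>)"
        using w_int[OF r] by simp
      show "AE \<omega> in lborel. norm (w r \<omega> * (cmod (\<G> \<omega>))\<^sup>2) \<le> norm (B\<^sup>2 * w r \<omega>)"
        using \<G>_bound by (auto simp: w_def mult.commute abs_mult intro!: mult_right_mono power_mono)
    qed measurable
    then have "(\<integral>\<^sup>+\<omega>. ennreal (w r \<omega> * (cmod (\<G> \<omega>))\<^sup>2) \<partial>lborel)
        = ennreal (LINT \<omega>|lborel. w r \<omega> * (cmod (\<G> \<omega>))\<^sup>2)"
      by (rule nn_integral_eq_integral) (simp add: w_def)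
    also have "\<dots> \<le> ennreal (cmod (LINT x|lborel. g x * (LINT y|lborel. cnj (g y) * ?K (x - y))))"
      unfolding eq[symmetric] by (intro ennreal_leI) simp
    also have "\<dots> \<le> (\<integral>\<^sup>+x. ennreal (cmod (g x * (LINT y|lborel. cnj (g y) * ?K (x - y)))) \<partial>lborel)"
      by (rule norm_le)
    also have "\<dots> \<le> (\<integral>\<^sup>+x. (\<integral>\<^sup>+y. ennreal (((cmod (g x))\<^sup>2 + (cmod (g y))\<^sup>2) / 2 * ?K (x - y)) \<partial>lborel) \<partial>lborel)"
    proof (rule nn_integral_mono)
      fix x
      have "ennreal (cmod (g x * (LINT y|lborel. cnj (g y) * ?K (x - y))))
          = ennreal (cmod (g x)) * ennreal (cmod (LINT y|lborel. cnj (g y) * ?K (x - y)))"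
        by (simp add: norm_mult ennreal_mult)
      also have "\<dots> \<le> ennreal (cmod (g x)) * (\<integral>\<^sup>+y. ennreal (cmod (cnj (g y) * ?K (x - y))) \<partial>lborel)"
        by (intro mult_left_mono norm_le) simp
      also have "\<dots> = (\<integral>\<^sup>+y. ennreal (cmod (g x)) * ennreal (cmod (cnj (g y) * ?K (x - y))) \<partial>lborel)"
        by (rule nn_integral_cmult[symmetric]) measurable
      also have "\<dots> \<le> (\<integral>\<^sup>+y. ennreal (((cmod (g x))\<^sup>2 + (cmod (g y))\<^sup>2) / 2 * ?K (x - y)) \<partial>lborel)"
      proof (rule nn_integral_mono)
        fix y
        \<comment> \<open>AM-GM decouples \<open>g x\<close> from \<open>g y\<close>.\<close>
        have "cmod (g x) * cmod (g y) * ?K (x - y) \<le> ((cmod (g x))\<^sup>2 + (cmod (g y))\<^sup>2) / 2 * ?K (x - y)"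
          using sum_squares_bound[of "cmod (g x)" "cmod (g y)"] by (intro mult_right_mono) auto
        then show "ennreal (cmod (g x)) * ennreal (cmod (cnj (g y) * ?K (x - y)))
            \<le> ennreal (((cmod (g x))\<^sup>2 + (cmod (g y))\<^sup>2) / 2 * ?K (x - y))"
          by (subst ennreal_mult[symmetric]) (auto simp: norm_mult mult_ac intro!: ennreal_leI)
      qed
      finally show "ennreal (cmod (g x * (LINT y|lborel. cnj (g y) * ?K (x - y))))
          \<le> (\<integral>\<^sup>+y. ennreal (((cmod (g x))\<^sup>2 + (cmod (g y))\<^sup>2) / 2 * ?K (x - y)) \<partial>lborel)" .
    qed
    \<comment> \<open>By symmetry \<open>?K\<close> has total mass one in either variable, so each
      summand contributes half of the squared norm of \<open>g\<close>.\<close>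
    also have "\<dots> = (\<integral>\<^sup>+x. (\<integral>\<^sup>+y. ennreal ((cmod (g x))\<^sup>2 / 2) * ennreal (?K (x - y)) \<partial>lborel) \<partial>lborel)
        + (\<integral>\<^sup>+x. (\<integral>\<^sup>+y. ennreal ((cmod (g y))\<^sup>2 / 2) * ennreal (?K (x - y)) \<partial>lborel) \<partial>lborel)"
    proof -
      have "ennreal (((cmod (g x))\<^sup>2 + (cmod (g y))\<^sup>2) / 2 * ?K (x - y))
          = ennreal ((cmod (g x))\<^sup>2 / 2) * ennreal (?K (x - y)) + ennreal ((cmod (g y))\<^sup>2 / 2) * ennreal (?K (x - y))"
        for x y
        by (simp add: ennreal_mult[symmetric] ennreal_plus[symmetric] add_divide_distrib distrib_right
            del: ennreal_plus)
      then show ?thesis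
        by (simp add: nn_integral_add)
    qed
    also have "(\<integral>\<^sup>+x. (\<integral>\<^sup>+y. ennreal ((cmod (g x))\<^sup>2 / 2) * ennreal (?K (x - y)) \<partial>lborel) \<partial>lborel)
        = (\<integral>\<^sup>+x. ennreal ((cmod (g x))\<^sup>2 / 2) \<partial>lborel)"
      by (simp add: nn_integral_cmult K_nn)
    also have "(\<integral>\<^sup>+x. (\<integral>\<^sup>+y. ennreal ((cmod (g y))\<^sup>2 / 2) * ennreal (?K (x - y)) \<partial>lborel) \<partial>lborel)
        = (\<integral>\<^sup>+y. (\<integral>\<^sup>+x. ennreal ((cmod (g y))\<^sup>2 / 2) * ennreal (?K (x - y)) \<partial>lborel) \<partial>lborel)"
      by (rule lborel_pair.Fubini') measurable
    also have "\<dots> = (\<integral>\<^sup>+y. ennreal ((cmod (g y))\<^sup>2 / 2) \<partial>lborel)"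
      by (simp add: nn_integral_cmult K_sym[of _ "_::real"] K_nn)
    also have "(\<integral>\<^sup>+x. ennreal ((cmod (g x))\<^sup>2 / 2) \<partial>lborel) + (\<integral>\<^sup>+x. ennreal ((cmod (g x))\<^sup>2 / 2) \<partial>lborel)
        = (\<integral>\<^sup>+x. ennreal ((cmod (g x))\<^sup>2) \<partial>lborel)"
      by (subst nn_integral_add[symmetric]) (auto simp: ennreal_plus[symmetric] simp del: ennreal_plus)
    finally show ?thesis .
  qed
  \<comment> \<open>The index \<open>Suc n\<close> keeps the width positive, as
    \<open>weighted\<close> requires; as the width tends to infinity the weight disappears in the
    limit.\<close>
  have w_lim: "(\<lambda>n. w (real (Suc n)) \<omega>) \<longlonglongrightarrow> 1" for \<omega>
  proof -
    have "(\<lambda>n. exp (- \<omega>\<^sup>2 / 2 * (inverse (real (Suc n)) * inverse (real (Suc n))))) \<longlonglongrightarrow> exp (- \<omega>\<^sup>2 / 2 * (0 * 0))"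
      by (intro tendsto_intros LIMSEQ_inverse_real_of_nat)
    then show ?thesis
      by (simp add: w_def power2_eq_square field_simps)
  qed
  have "(\<integral>\<^sup>+\<omega>. ennreal ((cmod (\<G> \<omega>))\<^sup>2) \<partial>lborel)
      = (\<integral>\<^sup>+\<omega>. liminf (\<lambda>n. ennreal (w (real (Suc n)) \<omega> * (cmod (\<G> \<omega>))\<^sup>2)) \<partial>lborel)"
  proof (intro nn_integral_cong lim_imp_Liminf[symmetric] tendsto_ennrealI)
    fix \<omega>
    show "(\<lambda>n. w (real (Suc n)) \<omega> * (cmod (\<G> \<omega>))\<^sup>2) \<longlonglongrightarrow> (cmod (\<G> \<omega>))\<^sup>2"
      using tendsto_mult[OF w_lim tendsto_const, of \<omega> "(cmod (\<G> \<omega>))\<^sup>2"] by simp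
  qed simp
  also have "\<dots> \<le> liminf (\<lambda>n. \<integral>\<^sup>+\<omega>. ennreal (w (real (Suc n)) \<omega> * (cmod (\<G> \<omega>))\<^sup>2) \<partial>lborel)"
    by (rule nn_integral_liminf) measurable
  also have "\<dots> \<le> (\<integral>\<^sup>+x. ennreal ((cmod (g x))\<^sup>2) \<partial>lborel)"
    by (intro Liminf_le always_eventually allI weighted) auto
  finally show ?thesis unfolding \<G>_def .
qed

section \<open>Transforms with decaying kernels\<close>

definition decay_energy :: "real \<Rightarrow> real" where
  "decay_energy m = (LINT u|lborel. (1 / (1 + m * \<bar>u\<bar>))\<^sup>2)"

text \<open>The square of \<open>1 + m * \<bar>u\<bar>\<close> dominates
  \<open>1 + (m * u)\<^sup>2\<close>, so a rescaling of the derivative of the arctangent is an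
  integrable majorant.\<close>

lemma decay_integrable:
  assumes m: "0 < m"
  shows "integrable lborel (\<lambda>u::real. (1 / (1 + m * \<bar>u\<bar>))\<^sup>2)"
proof (rule Bochner_Integration.integrable_bound)
  have "integrable lborel (\<lambda>x::real. inverse (1 + x\<^sup>2))"
    using integrable_inverse_1_plus_square by (simp add: set_integrable_def)
  then have "integrable lborel (\<lambda>x. inverse (1 + (0 + m * x)\<^sup>2))"
    using m by (subst lborel_integrable_real_affine_iff) auto
  then show "integrable lborel (\<lambda>x. inverse (1 + (m * x)\<^sup>2))"
    by simp
  show "AE u in lborel. norm ((1 / (1 + m * \<bar>u\<bar>))\<^sup>2) \<le> norm (inverse (1 + (m * u)\<^sup>2))"
  proof (rule AE_I2)
    fix u :: real
    have "1 + (m * u)\<^sup>2 \<le> (1 + m * \<bar>u\<bar>)\<^sup>2"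
      using m by (simp add: power2_sum power_mult_distrib)
    then show "norm ((1 / (1 + m * \<bar>u\<bar>))\<^sup>2) \<le> norm (inverse (1 + (m * u)\<^sup>2))"
      using sum_power2_gt_zero_iff[of 1 "m * u"]
      by (simp add: power_divide divide_inverse power_inverse le_imp_inverse_le)
  qed
qed measurable

lemma decay_integrable_shift:
  assumes "0 < m"
  shows "integrable lborel (\<lambda>t::real. (1 / (1 + m * \<bar>x - t\<bar>))\<^sup>2)"
proof -
  have "integrable lborel (\<lambda>t. (1 / (1 + m * \<bar>x + (-1) * t\<bar>))\<^sup>2)"
    by (subst lborel_integrable_real_affine_iff) (auto intro: decay_integrable[OF assms])
  then show ?thesis by simp
qed

lemma decay_energy_nonneg: "0 \<le> decay_energy m"
  by (simp add: decay_energy_def)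

lemma nn_integral_decay:
  assumes m: "0 < m"
  shows "(\<integral>\<^sup>+t. ennreal ((c / (1 + m * \<bar>x - t\<bar>))\<^sup>2) \<partial>lborel) = ennreal (c\<^sup>2 * decay_energy m)"
proof -
  have "(\<integral>\<^sup>+u. ennreal ((c / (1 + m * \<bar>u\<bar>))\<^sup>2) \<partial>lborel)
      = (\<integral>\<^sup>+u. ennreal (c\<^sup>2 * (1 / (1 + m * \<bar>u\<bar>))\<^sup>2) \<partial>lborel)"
    by (simp add: power_divide)
  also have "\<dots> = ennreal (LINT u|lborel. c\<^sup>2 * (1 / (1 + m * \<bar>u\<bar>))\<^sup>2)"
    using decay_integrable[OF m] by (intro nn_integral_eq_integral) auto
  also have "\<dots> = ennreal (c\<^sup>2 * decay_energy m)"
    by (simp add: decay_energy_def)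
  finally show ?thesis
    by (subst (asm) nn_integral_real_affine[where c = "-1" and t = x]) auto
qed

text \<open>One envelope shape for every kernel that occurs: the dilated windows, and the difference
  of two of them, where \<open>c\<close> is proportional to the distance of the scale functions.
  With \<open>m\<close> fixed, the operator bounds are linear in \<open>c\<close>.\<close>

locale decaying_kernel =
  fixes m c :: real and p :: "real \<Rightarrow> real \<Rightarrow> complex"
  assumes m_pos: "0 < m" and c_nonneg: "0 \<le> c"
    and kernel_measurable [measurable]: "(\<lambda>(t, x). p t x) \<in> borel_measurable (borel \<Otimes>\<^sub>M borel)"
    and decay: "cmod (p t x) \<le> c / (1 + m * \<bar>x - t\<bar>)"
begin

lemma atom_L2: "(\<lambda>x. wave \<omega> x * p t x) \<in> L2_space lborel"
proof (rule L2_spaceI_nn_integral)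
  have "(\<integral>\<^sup>+x. ennreal ((cmod (wave \<omega> x * p t x))\<^sup>2) \<partial>lborel)
      \<le> (\<integral>\<^sup>+x. ennreal ((c / (1 + m * \<bar>t - x\<bar>))\<^sup>2) \<partial>lborel)"
    using decay[of t] by (intro nn_integral_mono ennreal_leI power_mono) (auto simp: norm_mult abs_minus_commute)
  also have "\<dots> = ennreal ((c * sqrt (decay_energy m))\<^sup>2)"
    unfolding nn_integral_decay[OF m_pos] by (simp add: power_mult_distrib decay_energy_nonneg)
  finally show "(\<integral>\<^sup>+x. ennreal ((cmod (wave \<omega> x * p t x))\<^sup>2) \<partial>lborel) \<le> \<dots>" .
qed (auto simp: c_nonneg decay_energy_nonneg)

end

definition kernel_transform :: "(real \<Rightarrow> real \<Rightarrow> complex) \<Rightarrow> (real \<Rightarrow> complex) \<Rightarrow> real \<times> real \<Rightarrow> complex" where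
  "kernel_transform p f = (\<lambda>(t, \<omega>). L2_inner lborel f (\<lambda>x. wave \<omega> x * p t x))"

context decaying_kernel
begin

text \<open>For fixed \<open>t\<close> the transform is, in the frequency, the Fourier transform of
  \<open>f\<close> times the conjugate kernel, so Bessel bounds each slice. Tonelli then integrates
  the squared envelope over \<open>t\<close> first, which gives
  \<open>c\<^sup>2 * decay_energy m\<close> at every \<open>x\<close>.\<close>

lemma
  assumes f: "f \<in> L2_space lborel"
  shows kernel_transform_L2: "kernel_transform p f \<in> L2_space lborel"
    and kernel_transform_norm: "L2_norm lborel (kernel_transform p f) \<le> c * sqrt (decay_energy m) * L2_norm lborel f"
proof -
  note [measurable] = L2_space_measurable[OF f, simplified]
  have "kernel_transform p f \<in> borel_measurable (lborel \<Otimes>\<^sub>M lborel)"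
    unfolding kernel_transform_def L2_inner_def by measurable
  then have [measurable]: "kernel_transform p f \<in> borel_measurable borel"
    by (simp add: lborel_prod)
  have slice: "(\<integral>\<^sup>+\<omega>. ennreal ((cmod (kernel_transform p f (t, \<omega>)))\<^sup>2) \<partial>lborel)
      \<le> (\<integral>\<^sup>+x. ennreal ((cmod (f x))\<^sup>2) * ennreal ((c / (1 + m * \<bar>x - t\<bar>))\<^sup>2) \<partial>lborel)" for t
  proof -
    have "(\<integral>\<^sup>+\<omega>. ennreal ((cmod (kernel_transform p f (t, \<omega>)))\<^sup>2) \<partial>lborel)
        = (\<integral>\<^sup>+\<omega>. ennreal ((cmod (LINT x|lborel. (f x * cnj (p t x)) * cnj (wave \<omega> x)))\<^sup>2) \<partial>lborel)"
      by (simp add: kernel_transform_def L2_inner_def mult_ac)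
    \<comment> \<open>Bessel asks for an integrable function: \<open>f\<close> and the kernel are
      both square-integrable, and frequency 0 in \<open>atom_L2\<close> removes the wave.\<close>
    also have "\<dots> \<le> (\<integral>\<^sup>+x. ennreal ((cmod (f x * cnj (p t x)))\<^sup>2) \<partial>lborel)"
      using L2_inner_integrable[OF f atom_L2[of 0 t]] by (intro Bessel_nn_integral) (simp add: wave_def)
    also have "\<dots> \<le> (\<integral>\<^sup>+x. ennreal ((cmod (f x))\<^sup>2) * ennreal ((c / (1 + m * \<bar>x - t\<bar>))\<^sup>2) \<partial>lborel)"
      using decay
      by (intro nn_integral_mono)
         (auto simp: norm_mult power_mult_distrib ennreal_mult[symmetric]
           intro!: ennreal_leI mult_left_mono power_mono)
    finally show ?thesis .
  qed
  have "(\<integral>\<^sup>+z. ennreal ((cmod (kernel_transform p f z))\<^sup>2) \<partial>lborel)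
      = (\<integral>\<^sup>+t. \<integral>\<^sup>+\<omega>. ennreal ((cmod (kernel_transform p f (t, \<omega>)))\<^sup>2) \<partial>lborel \<partial>lborel)"
    unfolding lborel_prod[symmetric] by (subst lborel.nn_integral_fst[symmetric]) (auto simp: lborel_prod)
  also have "\<dots> \<le> (\<integral>\<^sup>+t. \<integral>\<^sup>+x. ennreal ((cmod (f x))\<^sup>2) * ennreal ((c / (1 + m * \<bar>x - t\<bar>))\<^sup>2) \<partial>lborel \<partial>lborel)"
    by (intro nn_integral_mono slice)
  also have "\<dots> = (\<integral>\<^sup>+x. \<integral>\<^sup>+t. ennreal ((cmod (f x))\<^sup>2) * ennreal ((c / (1 + m * \<bar>x - t\<bar>))\<^sup>2) \<partial>lborel \<partial>lborel)"
    by (rule lborel_pair.Fubini') measurable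
  also have "\<dots> = (\<integral>\<^sup>+x. ennreal ((cmod (f x))\<^sup>2) * ennreal (c\<^sup>2 * decay_energy m) \<partial>lborel)"
    by (simp add: nn_integral_cmult nn_integral_decay[OF m_pos])
  also have "\<dots> = ennreal ((L2_norm lborel f)\<^sup>2) * ennreal (c\<^sup>2 * decay_energy m)"
    by (subst nn_integral_multc) (auto simp: nn_integral_L2_norm[OF f])
  also have "\<dots> = ennreal ((c * sqrt (decay_energy m) * L2_norm lborel f)\<^sup>2)"
    by (simp add: ennreal_mult[symmetric] decay_energy_nonneg power_mult_distrib mult_ac)
  finally have le: "(\<integral>\<^sup>+z. ennreal ((cmod (kernel_transform p f z))\<^sup>2) \<partial>lborel)
      \<le> ennreal ((c * sqrt (decay_energy m) * L2_norm lborel f)\<^sup>2)" by simp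
  have "0 \<le> c * sqrt (decay_energy m) * L2_norm lborel f"
    by (simp add: c_nonneg decay_energy_nonneg L2_norm_nonneg)
  from L2_spaceI_nn_integral[OF _ le this]
  show "kernel_transform p f \<in> L2_space lborel"
    and "L2_norm lborel (kernel_transform p f) \<le> c * sqrt (decay_energy m) * L2_norm lborel f"
    by simp_all
qed

section \<open>Adjoints of transforms with decaying kernels\<close>

lemma
  assumes F: "F \<in> L2_space lborel"
  shows kernel_adjoint_L2: "L2_adjoint lborel lborel (kernel_transform p) F \<in> L2_space lborel"
    and kernel_adjoint_eq: "\<And>f. f \<in> L2_space lborel \<Longrightarrow> L2_inner lborel (kernel_transform p f) F
      = L2_inner lborel f (L2_adjoint lborel lborel (kernel_transform p) F)"
proof -
  have add: "kernel_transform p (\<lambda>x. f x + g x) = (\<lambda>y. kernel_transform p f y + kernel_transform p g y)"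
    if "f \<in> L2_space lborel" "g \<in> L2_space lborel" for f g
    using that by (auto simp: kernel_transform_def L2_inner_add_left atom_L2 fun_eq_iff)
  have cmult: "kernel_transform p (\<lambda>x. a * f x) = (\<lambda>y. a * kernel_transform p f y)" for a f
    by (auto simp: kernel_transform_def L2_inner_cmult_left fun_eq_iff)
  note * = L2_adjoint_exists[of lborel "kernel_transform p", OF kernel_transform_L2 add cmult kernel_transform_norm F]
  show "L2_adjoint lborel lborel (kernel_transform p) F \<in> L2_space lborel"
    by (rule *)
  show "L2_inner lborel (kernel_transform p f) F
      = L2_inner lborel f (L2_adjoint lborel lborel (kernel_transform p) F)" if "f \<in> L2_space lborel" for f
    by (rule *(2)) (use that in auto)
qed

lemma kernel_adjoint_norm:
  assumes F: "F \<in> L2_space lborel"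
  shows "L2_norm lborel (L2_adjoint lborel lborel (kernel_transform p) F)
    \<le> c * sqrt (decay_energy m) * L2_norm lborel F"
proof -
  note G = kernel_adjoint_L2[OF F]
  show ?thesis
    by (rule L2_norm_le_dual[OF G kernel_transform_L2[OF G] F kernel_adjoint_eq[OF F G, symmetric]
          kernel_transform_norm[OF G]])
       (simp add: c_nonneg decay_energy_nonneg)
qed

end

text \<open>Test the difference \<open>?D\<close> of the two adjoint values against itself: its
  squared norm is the inner product of the transform of \<open>?D\<close> with kernel
  \<open>p - p'\<close> and \<open>F\<close>, so the envelope constant \<open>d\<close> of that
  kernel controls the bound.\<close>

lemma kernel_adjoint_diff_norm:
  assumes p: "decaying_kernel m c p" and p': "decaying_kernel m c' p'"
    and d: "decaying_kernel m d (\<lambda>t x. p t x - p' t x)"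
    and F: "F \<in> L2_space lborel"
  shows "L2_norm lborel (\<lambda>x. L2_adjoint lborel lborel (kernel_transform p) F x
      - L2_adjoint lborel lborel (kernel_transform p') F x)
    \<le> d * sqrt (decay_energy m) * L2_norm lborel F"
proof -
  interpret p: decaying_kernel m c p by fact
  interpret p': decaying_kernel m c' p' by fact
  interpret d: decaying_kernel m d "\<lambda>t x. p t x - p' t x" by fact
  let ?G = "L2_adjoint lborel lborel (kernel_transform p) F"
  let ?G' = "L2_adjoint lborel lborel (kernel_transform p') F"
  let ?D = "\<lambda>x. ?G x - ?G' x"
  note G = p.kernel_adjoint_L2[OF F] p'.kernel_adjoint_L2[OF F]
  have D: "?D \<in> L2_space lborel"
    by (rule L2_space_diff[OF G])
  have diff: "kernel_transform (\<lambda>t x. p t x - p' t x) ?D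
      = (\<lambda>z. kernel_transform p ?D z - kernel_transform p' ?D z)"
    by (auto simp: kernel_transform_def fun_eq_iff right_diff_distrib L2_inner_diff_right D
        p.atom_L2 p'.atom_L2)
  have "L2_inner lborel ?D ?D
      = L2_inner lborel (kernel_transform p ?D) F - L2_inner lborel (kernel_transform p' ?D) F"
    unfolding p.kernel_adjoint_eq[OF F D] p'.kernel_adjoint_eq[OF F D]
    by (rule L2_inner_diff_right[OF G D])
  also have "\<dots> = L2_inner lborel (kernel_transform (\<lambda>t x. p t x - p' t x) ?D) F"
    unfolding diff by (rule L2_inner_diff_left[symmetric, OF p.kernel_transform_L2[OF D] p'.kernel_transform_L2[OF D] F])
  finally show ?thesis
    by (rule L2_norm_le_dual[OF D d.kernel_transform_L2[OF D] F _ d.kernel_transform_norm[OF D]])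
       (simp add: d.c_nonneg decay_energy_nonneg)
qed

section \<open>Dilations of the window\<close>

text \<open>Convergence to 1 keeps the function below 2 on both tails, and continuity bounds it on
  the compact interval between them; if \<open>b\<close> exceeds \<open>a\<close>, that interval is
  empty and the tails cover the line.\<close>

lemma Phi_class_bounded:
  assumes "\<sigma> \<in> Phi_class m"
  obtains M where "\<And>t. \<sigma> t \<le> M"
proof -
  have cont: "continuous_on UNIV \<sigma>" and top: "(\<sigma> \<longlongrightarrow> 1) at_top" and bot: "(\<sigma> \<longlongrightarrow> 1) at_bot"
    using assms by (auto simp: Phi_class_def)
  obtain a where a: "\<And>t. a \<le> t \<Longrightarrow> \<sigma> t < 2"
    using order_tendstoD(2)[OF top, of 2] by (auto simp: eventually_at_top_linorder)
  obtain b where b: "\<And>t. t \<le> b \<Longrightarrow> \<sigma> t < 2"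
    using order_tendstoD(2)[OF bot, of 2] by (auto simp: eventually_at_bot_linorder)
  have "compact (\<sigma> ` {b..a})"
    by (intro compact_continuous_image continuous_on_subset[OF cont]) auto
  then have "bdd_above (\<sigma> ` {b..a})"
    by (intro bounded_imp_bdd_above compact_imp_bounded)
  then obtain c where "\<forall>y \<in> \<sigma> ` {b..a}. y \<le> c"
    unfolding bdd_above_def by blast
  then have c: "b \<le> t \<Longrightarrow> t \<le> a \<Longrightarrow> \<sigma> t \<le> c" for t
    by auto
  have "\<sigma> t \<le> max 2 c" for t
    using a[of t] b[of t] c[of t] by (cases "a \<le> t"; cases "t \<le> b") (auto simp: le_max_iff_disj less_imp_le)
  then show ?thesis by (rule that)
qed

text \<open>The set where the absolute value of \<open>f\<close> is at most the essential supremum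
  has full measure and is closed by continuity, hence is the whole line.\<close>

lemma abs_le_Linf_norm:
  assumes cont: "continuous_on UNIV f" and bound: "\<And>t. \<bar>f t\<bar> \<le> b"
  shows "\<bar>f t\<bar> \<le> Linf_norm f"
proof -
  have [measurable]: "f \<in> borel_measurable borel"
    by (rule borel_measurable_continuous_onI[OF cont])
  define e where "e = esssup lborel (\<lambda>t. ereal \<bar>f t\<bar>)"
  have "AE t in lborel. ereal \<bar>f t\<bar> \<le> e"
    unfolding e_def by (rule esssup_AE)
  \<comment> \<open>This rules out an infinite essential supremum, for which
    \<open>real_of_ereal\<close> would return 0.\<close>
  moreover have "e \<le> ereal b"
    unfolding e_def by (rule esssup_I) (auto simp: bound)
  ultimately have e: "AE t in lborel. t \<in> {t. \<bar>f t\<bar> \<le> real_of_ereal e}"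
    by (cases e) (auto elim: eventually_mono)
  have "closed {t. \<bar>f t\<bar> \<le> real_of_ereal e}"
    using cont by (intro closed_Collect_le continuous_intros) auto
  from mem_closed_if_AE_lebesgue[OF this AE_completion[OF e], of t]
  show ?thesis by (simp add: Linf_norm_def e_def)
qed

text \<open>If the integral vanished, the zero set of \<open>f\<close> would be closed and of full
  measure, hence contain \<open>a\<close>.\<close>

lemma lborel_integral_pos:
  fixes f :: "real \<Rightarrow> real"
  assumes cont: "continuous_on UNIV f" and int: "integrable lborel f"
    and nonneg: "\<And>x. 0 \<le> f x" and pos: "f a \<noteq> 0"
  shows "0 < integral\<^sup>L lborel f"
proof (rule ccontr)
  assume "\<not> 0 < integral\<^sup>L lborel f"
  moreover have "0 \<le> integral\<^sup>L lborel f"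
    by (rule Bochner_Integration.integral_nonneg) (rule nonneg)
  ultimately have "integral\<^sup>L lborel f = 0"
    by linarith
  then have *: "AE x in lborel. x \<in> {x. f x = 0}"
    using integral_nonneg_eq_0_iff_AE[OF int] nonneg by simp
  have "closed {x. f x = 0}"
    using cont by (intro closed_Collect_eq) auto
  from mem_closed_if_AE_lebesgue[OF this AE_completion[OF *], of a] pos
  show False by simp
qed

text \<open>The functions bounding \<open>h\<close> and its derivative are replaced by constant
  upper bounds; \<open>m\<close> is the common lower bound of the scale functions.\<close>

locale window =
  fixes h h' :: "real \<Rightarrow> complex" and \<Psi> \<Phi> m :: real
  assumes m_pos: "0 < m" and \<Psi>_nonneg: "0 \<le> \<Psi>" and \<Phi>_nonneg: "0 \<le> \<Phi>"
    and h_deriv: "(h has_vector_derivative h' t) (at t)"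
    and h_bound: "cmod (h t) \<le> \<Psi> / (1 + \<bar>t\<bar>)"
    and h'_bound: "cmod (h' t) \<le> \<Phi> / (1 + t\<^sup>2)"
begin

section \<open>Decay of the dilated window and its Lipschitz dependence on the scale\<close>

lemma h_continuous: "continuous_on UNIV h"
  using h_deriv by (intro continuous_at_imp_continuous_on) (auto intro: has_vector_derivative_continuous)

lemma h_measurable [measurable]: "h \<in> borel_measurable borel"
  by (rule borel_measurable_continuous_onI[OF h_continuous])

lemma dilate_bound:
  assumes "m \<le> s" "s \<le> M"
  shows "cmod (sqrt s * h (s * u)) \<le> sqrt M * \<Psi> / (1 + m * \<bar>u\<bar>)"
proof -
  have "0 < s" using assms m_pos by simp
  have "cmod (sqrt s * h (s * u)) \<le> sqrt M * (\<Psi> / (1 + \<bar>s * u\<bar>))"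
    unfolding norm_mult using assms \<open>0 < s\<close> by (intro mult_mono h_bound) auto
  also have "\<dots> \<le> sqrt M * (\<Psi> / (1 + m * \<bar>u\<bar>))"
  proof (intro mult_left_mono divide_left_mono)
    show "1 + m * \<bar>u\<bar> \<le> 1 + \<bar>s * u\<bar>"
      using assms \<open>0 < s\<close> by (simp add: abs_mult mult_right_mono)
    show "0 < (1 + \<bar>s * u\<bar>) * (1 + m * \<bar>u\<bar>)"
      using m_pos by (intro mult_pos_pos add_pos_nonneg) auto
    show "0 \<le> sqrt M" using assms \<open>0 < s\<close> by simp
  qed (rule \<Psi>_nonneg)
  finally show ?thesis by simp
qed

text \<open>Bounds the derivative of \<open>sqrt s * h (s * u)\<close> in \<open>s\<close>, up to
  the envelope: \<open>\<Psi> / 2\<close> comes from differentiating the square root,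
  \<open>2 * \<Phi>\<close> from the chain rule, and \<open>1 / sqrt m\<close> from bounding
  \<open>1 / sqrt s\<close>.\<close>

definition Lip :: real where
  "Lip = (\<Psi> / 2 + 2 * \<Phi>) / sqrt m"

lemma Lip_nonneg: "0 \<le> Lip"
  using m_pos \<Psi>_nonneg \<Phi>_nonneg by (simp add: Lip_def)

text \<open>Mean value inequality on the convex half-line \<open>{m..}\<close>. The chain rule
  produces a growing factor \<open>u\<close>; the quadratic decay of \<open>h'\<close> absorbs it
  and leaves first-order decay, uniformly in the scale.\<close>

lemma dilate_lipschitz:
  assumes s: "m \<le> s" and s': "m \<le> s'"
  shows "cmod (sqrt s * h (s * u) - sqrt s' * h (s' * u)) \<le> Lip * \<bar>s - s'\<bar> / (1 + m * \<bar>u\<bar>)"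
proof -
  let ?D = "\<lambda>s. sqrt s *\<^sub>R (u *\<^sub>R h' (s * u)) + (inverse (sqrt s) / 2) *\<^sub>R h (s * u)"
  have deriv: "((\<lambda>s. sqrt s *\<^sub>R h (s * u)) has_vector_derivative ?D s) (at s within {m..})"
    if "s \<in> {m..}" for s
  proof -
    have "0 < s" using that m_pos by simp
    have "((h \<circ> (\<lambda>s. s * u)) has_vector_derivative (u *\<^sub>R h' (s * u))) (at s)"
      by (intro vector_diff_chain_at h_deriv) (auto intro!: derivative_eq_intros)
    then have "((\<lambda>s. h (s * u)) has_vector_derivative (u *\<^sub>R h' (s * u))) (at s)"
      by (simp add: o_def)
    then have "((\<lambda>s. sqrt s *\<^sub>R h (s * u)) has_vector_derivative ?D s) (at s)"
      using \<open>0 < s\<close> by (intro has_vector_derivative_scaleR DERIV_real_sqrt)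
    then show ?thesis by (rule has_vector_derivative_at_within)
  qed
  have D_bound: "cmod (?D s) \<le> Lip / (1 + m * \<bar>u\<bar>)" if "s \<in> {m..}" for s
  proof -
    have s: "0 < s" "m \<le> s" using that m_pos by auto
    define y where "y = \<bar>s * u\<bar>"
    have y: "0 \<le> y" "m * \<bar>u\<bar> \<le> y"
      using s m_pos by (auto simp: y_def abs_mult mult_right_mono)
    have "inverse (sqrt s) \<le> 1 / sqrt m"
      using s m_pos by (simp add: divide_simps)
    have "cmod (?D s) \<le> sqrt s * (\<bar>u\<bar> * cmod (h' (s * u))) + inverse (sqrt s) / 2 * cmod (h (s * u))"
      using s by (intro norm_triangle_le) (simp add: abs_mult)
    \<comment> \<open>Writing \<open>sqrt s * \<bar>u\<bar>\<close> as \<open>y / sqrt s\<close>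
      expresses the growing factor through the argument of \<open>h'\<close>, where the decay can
      compensate it.\<close>
    also have "sqrt s * (\<bar>u\<bar> * cmod (h' (s * u))) = inverse (sqrt s) * (y * cmod (h' (s * u)))"
      using s by (subst real_div_sqrt[symmetric]) (simp_all add: y_def abs_mult divide_inverse)
    also have "y * cmod (h' (s * u)) \<le> 2 * \<Phi> / (1 + y)"
    proof -
      have "y * cmod (h' (s * u)) \<le> (1 + y) * (\<Phi> / (1 + y\<^sup>2))"
        using y h'_bound[of "s * u"] by (intro mult_mono) (auto simp: y_def)
      also have "\<dots> \<le> 2 * \<Phi> / (1 + y)"
      proof -
        \<comment> \<open>Source of the factor 2 in front of \<open>\<Phi>\<close>.\<close>
        have "(1 + y) * (1 + y) \<le> 2 * (1 + y\<^sup>2)"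
          using sum_squares_bound[of 1 y] by (simp add: power2_eq_square algebra_simps)
        from mult_left_mono[OF this \<Phi>_nonneg] show ?thesis
          using y by (simp add: divide_simps add_pos_nonneg) (simp add: algebra_simps)
      qed
      finally show ?thesis .
    qed
    also have "cmod (h (s * u)) \<le> \<Psi> / (1 + y)"
      using h_bound[of "s * u"] by (simp add: y_def)
    also have "inverse (sqrt s) * (2 * \<Phi> / (1 + y)) + inverse (sqrt s) / 2 * (\<Psi> / (1 + y))
        = inverse (sqrt s) * ((\<Psi> / 2 + 2 * \<Phi>) / (1 + y))"
      by (simp add: add_divide_distrib algebra_simps)
    also have "\<dots> \<le> (1 / sqrt m) * ((\<Psi> / 2 + 2 * \<Phi>) / (1 + m * \<bar>u\<bar>))"
      using \<open>inverse (sqrt s) \<le> 1 / sqrt m\<close> y s m_pos \<Psi>_nonneg \<Phi>_nonneg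
      by (intro mult_mono divide_left_mono) (auto intro!: mult_pos_pos add_pos_nonneg divide_nonneg_pos)
    finally show ?thesis
      using s by (simp add: Lip_def)
  qed
  have "cmod (sqrt s *\<^sub>R h (s * u) - sqrt s' *\<^sub>R h (s' * u)) \<le> Lip / (1 + m * \<bar>u\<bar>) * norm (s - s')"
  proof (rule differentiable_bound[where S = "{m..}" and f' = "\<lambda>s x. x *\<^sub>R ?D s"])
    show "((\<lambda>s. sqrt s *\<^sub>R h (s * u)) has_derivative (\<lambda>x. x *\<^sub>R ?D s)) (at s within {m..})" if "s \<in> {m..}" for s
      using deriv[OF that] unfolding has_vector_derivative_def .
    show "onorm (\<lambda>x. x *\<^sub>R ?D s) \<le> Lip / (1 + m * \<bar>u\<bar>)" if "s \<in> {m..}" for s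
    proof (rule onorm_le)
      fix x :: real
      show "norm (x *\<^sub>R ?D s) \<le> Lip / (1 + m * \<bar>u\<bar>) * norm x"
        unfolding norm_scaleR real_norm_def mult.commute[of "\<bar>x\<bar>"]
        by (intro mult_right_mono D_bound that) auto
    qed
  qed (use s s' in auto)
  then show ?thesis by (simp add: scaleR_conv_of_real)
qed

section \<open>From dilations of the window to decaying kernels\<close>

definition dilation :: "(real \<Rightarrow> real) \<Rightarrow> real \<Rightarrow> real \<Rightarrow> complex" where
  "dilation \<sigma> t x = sqrt (\<sigma> t) * h (\<sigma> t * (x - t))"

lemma dilation_decaying:
  assumes cont: "continuous_on UNIV \<sigma>" and lower: "\<And>t. m \<le> \<sigma> t" and upper: "\<And>t. \<sigma> t \<le> M"
  shows "decaying_kernel m (sqrt M * \<Psi>) (dilation \<sigma>)"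
proof
  have [measurable]: "\<sigma> \<in> borel_measurable borel"
    by (rule borel_measurable_continuous_onI[OF cont])
  show "(\<lambda>(t, x). dilation \<sigma> t x) \<in> borel_measurable (borel \<Otimes>\<^sub>M borel)"
    unfolding dilation_def by measurable
  show "cmod (dilation \<sigma> t x) \<le> sqrt M * \<Psi> / (1 + m * \<bar>x - t\<bar>)" for t x
    unfolding dilation_def by (rule dilate_bound[OF lower upper])
  have "0 \<le> M" using lower[of 0] upper[of 0] m_pos by linarith
  then show "0 \<le> sqrt M * \<Psi>" using \<Psi>_nonneg by simp
qed (rule m_pos)

lemma dilation_diff_decaying:
  assumes \<sigma>: "continuous_on UNIV \<sigma>" "\<And>t. m \<le> \<sigma> t" and \<kappa>: "continuous_on UNIV \<kappa>" "\<And>t. m \<le> \<kappa> t"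
    and diff: "\<And>t. \<bar>\<sigma> t - \<kappa> t\<bar> \<le> \<delta>"
  shows "decaying_kernel m (Lip * \<delta>) (\<lambda>t x. dilation \<sigma> t x - dilation \<kappa> t x)"
proof
  have [measurable]: "\<sigma> \<in> borel_measurable borel" "\<kappa> \<in> borel_measurable borel"
    by (auto intro: borel_measurable_continuous_onI \<sigma> \<kappa>)
  show "(\<lambda>(t, x). dilation \<sigma> t x - dilation \<kappa> t x) \<in> borel_measurable (borel \<Otimes>\<^sub>M borel)"
    unfolding dilation_def by measurable
  have "cmod (dilation \<sigma> t x - dilation \<kappa> t x) \<le> Lip * \<bar>\<sigma> t - \<kappa> t\<bar> / (1 + m * \<bar>x - t\<bar>)" for t x
    unfolding dilation_def by (rule dilate_lipschitz[OF \<sigma>(2) \<kappa>(2)])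
  moreover have "Lip * \<bar>\<sigma> t - \<kappa> t\<bar> / (1 + m * \<bar>x - t\<bar>) \<le> Lip * \<delta> / (1 + m * \<bar>x - t\<bar>)" for t x
    using m_pos by (intro divide_right_mono mult_left_mono diff Lip_nonneg) auto
  ultimately show "cmod (dilation \<sigma> t x - dilation \<kappa> t x) \<le> Lip * \<delta> / (1 + m * \<bar>x - t\<bar>)" for t x
    using order_trans by blast
  show "0 \<le> Lip * \<delta>"
    using diff[of 0] Lip_nonneg by auto
qed (rule m_pos)

lemma transform_eq: "transform h \<sigma> = kernel_transform (dilation \<sigma>)"
proof -
  have "atom h \<sigma> t \<omega> = (\<lambda>x. wave \<omega> x * dilation \<sigma> t x)" for t \<omega>
    by (simp add: atom_def dilation_def wave_def fun_eq_iff)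
  then show ?thesis
    by (intro ext) (simp add: transform_def kernel_transform_def)
qed

section \<open>The frame weight\<close>

lemma frame_weight_eq_norm:
  assumes "\<And>t. m \<le> \<sigma> t"
  shows "frame_weight h \<sigma> x = (LINT t|lborel. (cmod (dilation \<sigma> t x))\<^sup>2)"
proof -
  have "0 \<le> \<sigma> t" for t
    using assms[of t] m_pos by linarith
  then show ?thesis
    by (simp add: frame_weight_def dilation_def norm_mult power_mult_distrib)
qed

lemma frame_weight_measurable:
  assumes "continuous_on UNIV \<sigma>"
  shows "frame_weight h \<sigma> \<in> borel_measurable borel"
proof -
  have [measurable]: "\<sigma> \<in> borel_measurable borel"
    by (rule borel_measurable_continuous_onI[OF assms])
  show ?thesis unfolding frame_weight_def by measurable
qed

lemma kernel_power2_integrable: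
  assumes "decaying_kernel m c p"
  shows "integrable lborel (\<lambda>t. (cmod (p t x))\<^sup>2)"
proof (rule Bochner_Integration.integrable_bound)
  interpret decaying_kernel m c p by fact
  show "integrable lborel (\<lambda>t. c\<^sup>2 * (1 / (1 + m * \<bar>x - t\<bar>))\<^sup>2)"
    by (intro integrable_mult_right decay_integrable_shift m_pos)
  have "(cmod (p t x))\<^sup>2 \<le> (c / (1 + m * \<bar>x - t\<bar>))\<^sup>2" for t
    using decay by (intro power_mono) auto
  then show "AE t in lborel. norm ((cmod (p t x))\<^sup>2) \<le> norm (c\<^sup>2 * (1 / (1 + m * \<bar>x - t\<bar>))\<^sup>2)"
    by (simp add: power_divide)
  show "(\<lambda>t. (cmod (p t x))\<^sup>2) \<in> borel_measurable lborel" by measurable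
qed

text \<open>Factor the difference of squared moduli: one factor carries
  \<open>Lip * \<delta>\<close>, the other twice the envelope constant
  \<open>sqrt M * \<Psi>\<close>. Each decays to first order, so the product is bounded by a
  function whose integral is independent of \<open>x\<close>.\<close>

lemma frame_weight_diff:
  assumes \<sigma>: "continuous_on UNIV \<sigma>" "\<And>t. m \<le> \<sigma> t" "\<And>t. \<sigma> t \<le> M"
    and \<kappa>: "continuous_on UNIV \<kappa>" "\<And>t. m \<le> \<kappa> t" "\<And>t. \<kappa> t \<le> M"
    and diff: "\<And>t. \<bar>\<sigma> t - \<kappa> t\<bar> \<le> \<delta>"
  shows "\<bar>frame_weight h \<sigma> x - frame_weight h \<kappa> x\<bar> \<le> 2 * sqrt M * \<Psi> * Lip * decay_energy m * \<delta>"
proof -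
  let ?q = "\<lambda>t. 1 / (1 + m * \<bar>x - t\<bar>)"
  interpret \<sigma>: decaying_kernel m "sqrt M * \<Psi>" "dilation \<sigma>" by (rule dilation_decaying[OF \<sigma>])
  interpret \<kappa>: decaying_kernel m "sqrt M * \<Psi>" "dilation \<kappa>" by (rule dilation_decaying[OF \<kappa>])
  interpret d: decaying_kernel m "Lip * \<delta>" "\<lambda>t x. dilation \<sigma> t x - dilation \<kappa> t x"
    by (rule dilation_diff_decaying[OF \<sigma>(1,2) \<kappa>(1,2) diff])
  let ?C = "2 * sqrt M * \<Psi> * Lip * \<delta>"
  have pointwise: "\<bar>(cmod (dilation \<sigma> t x))\<^sup>2 - (cmod (dilation \<kappa> t x))\<^sup>2\<bar> \<le> ?C * (?q t)\<^sup>2" for t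
  proof -
    have "\<bar>(cmod (dilation \<sigma> t x))\<^sup>2 - (cmod (dilation \<kappa> t x))\<^sup>2\<bar>
        = \<bar>cmod (dilation \<sigma> t x) - cmod (dilation \<kappa> t x)\<bar> * (cmod (dilation \<sigma> t x) + cmod (dilation \<kappa> t x))"
      by (simp add: power2_eq_square square_diff_square_factored abs_mult mult.commute)
    also have "\<dots> \<le> cmod (dilation \<sigma> t x - dilation \<kappa> t x) * (cmod (dilation \<sigma> t x) + cmod (dilation \<kappa> t x))"
      by (intro mult_right_mono norm_triangle_ineq3) auto
    also have "\<dots> \<le> (Lip * \<delta> / (1 + m * \<bar>x - t\<bar>)) *
        (sqrt M * \<Psi> / (1 + m * \<bar>x - t\<bar>) + sqrt M * \<Psi> / (1 + m * \<bar>x - t\<bar>))"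
      using d.c_nonneg m_pos
      by (intro mult_mono add_mono d.decay \<sigma>.decay \<kappa>.decay) auto
    also have "\<dots> = ?C * (?q t)\<^sup>2"
      by (simp add: power2_eq_square)
    finally show ?thesis .
  qed
  have q_int: "integrable lborel (\<lambda>t. (?q t)\<^sup>2)"
    by (rule decay_integrable_shift[OF m_pos])
  have q_eq: "(LINT t|lborel. (?q t)\<^sup>2) = decay_energy m"
    unfolding decay_energy_def
    by (subst lborel_integral_real_affine[where c = "-1" and t = x and f = "\<lambda>u. (1 / (1 + m * \<bar>u\<bar>))\<^sup>2"]) auto
  note int = kernel_power2_integrable[OF \<sigma>.decaying_kernel_axioms] kernel_power2_integrable[OF \<kappa>.decaying_kernel_axioms]
  have "\<bar>frame_weight h \<sigma> x - frame_weight h \<kappa> x\<bar>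
      = norm (LINT t|lborel. (cmod (dilation \<sigma> t x))\<^sup>2 - (cmod (dilation \<kappa> t x))\<^sup>2)"
    unfolding frame_weight_eq_norm[OF \<sigma>(2)] frame_weight_eq_norm[OF \<kappa>(2)] using int by simp
  also have "\<dots> \<le> (LINT t|lborel. ?C * (?q t)\<^sup>2)"
    by (rule Bochner_Integration.integral_norm_bound_integral)
       (use int q_int pointwise in \<open>auto intro!: Bochner_Integration.integrable_diff\<close>)
  also have "\<dots> = ?C * decay_energy m"
    using q_eq by simp
  finally show ?thesis by (simp add: mult_ac)
qed

section \<open>Uniform positivity of the frame weight\<close>

lemma frame_weight_shifted:
  "frame_weight h \<sigma> x = (LINT u|lborel. \<sigma> (x - u) * (cmod (h (\<sigma> (x - u) * u)))\<^sup>2)"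
  unfolding frame_weight_def
  by (subst lborel_integral_real_affine[where c = "-1" and t = x]) auto

text \<open>After the substitution in \<open>frame_weight_shifted\<close> the point \<open>x\<close>
  enters only through the scale \<open>s = \<sigma> (x - u)\<close>, so this majorant serves all
  points at once.\<close>

lemma profile_bound:
  assumes "m \<le> s" "s \<le> M"
  shows "\<bar>s * (cmod (h (s * u)))\<^sup>2\<bar> \<le> (sqrt M * \<Psi>)\<^sup>2 * (1 / (1 + m * \<bar>u\<bar>))\<^sup>2"
proof -
  have "0 \<le> s" using assms m_pos by simp
  then have "\<bar>s * (cmod (h (s * u)))\<^sup>2\<bar> = (cmod (sqrt s * h (s * u)))\<^sup>2"
    by (simp add: norm_mult power_mult_distrib abs_mult)
  also have "\<dots> \<le> (sqrt M * \<Psi> / (1 + m * \<bar>u\<bar>))\<^sup>2"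
    by (intro power_mono dilate_bound assms) auto
  finally show ?thesis by (simp add: power_divide)
qed

lemma profile_integrable:
  assumes "s \<in> borel_measurable borel" "\<And>u. m \<le> s u" "\<And>u. s u \<le> M"
  shows "integrable lborel (\<lambda>u. s u * (cmod (h (s u * u)))\<^sup>2)"
proof (rule Bochner_Integration.integrable_bound)
  note [measurable] = assms(1)
  show "integrable lborel (\<lambda>u. (sqrt M * \<Psi>)\<^sup>2 * (1 / (1 + m * \<bar>u\<bar>))\<^sup>2)"
    by (intro integrable_mult_right decay_integrable m_pos)
  show "(\<lambda>u. s u * (cmod (h (s u * u)))\<^sup>2) \<in> borel_measurable lborel" by measurable
  show "AE u in lborel. norm (s u * (cmod (h (s u * u)))\<^sup>2) \<le> norm ((sqrt M * \<Psi>)\<^sup>2 * (1 / (1 + m * \<bar>u\<bar>))\<^sup>2)"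
    using profile_bound[OF assms(2,3)] by simp
qed

text \<open>The map \<open>u \<mapsto> s u * u\<close> is onto by the intermediate value theorem, so it hits a point where
  \<open>h\<close> does not vanish.\<close>

lemma profile_integral_pos:
  assumes cont: "continuous_on UNIV s" and lower: "\<And>u. m \<le> s u" and upper: "\<And>u. s u \<le> M"
    and "h y \<noteq> 0"
  shows "0 < (LINT u|lborel. s u * (cmod (h (s u * u)))\<^sup>2)"
proof -
  \<comment> \<open>At \<open>u = b\<close> and \<open>u = - b\<close> a scale of at least
    \<open>m\<close> carries the map to or beyond \<open>y\<close> on either side.\<close>
  define b where "b = \<bar>y\<bar> / m"
  have "0 \<le> b" using m_pos by (simp add: b_def)
  have "\<bar>y\<bar> \<le> s u * b" for u
    using mult_right_mono[OF lower[of u] \<open>0 \<le> b\<close>] m_pos by (simp add: b_def)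
  from this[of b] this[of "- b"] have "s (- b) * (- b) \<le> y" "y \<le> s b * b"
    by auto
  moreover have "continuous_on {- b..b} (\<lambda>u. s u * u)"
    by (intro continuous_intros continuous_on_subset[OF cont]) auto
  ultimately obtain a where "s a * a = y"
    using IVT'[of "\<lambda>u. s u * u" "- b" y b] \<open>0 \<le> b\<close> by auto
  show ?thesis
  proof (rule lborel_integral_pos[where a = a])
    show "continuous_on UNIV (\<lambda>u. s u * (cmod (h (s u * u)))\<^sup>2)"
      by (intro continuous_intros cont continuous_on_compose2[OF h_continuous]) auto
    show "integrable lborel (\<lambda>u. s u * (cmod (h (s u * u)))\<^sup>2)"
      by (rule profile_integrable[OF borel_measurable_continuous_onI[OF cont] lower upper])
    have s: "0 < s u" for u using lower[of u] m_pos by linarith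
    show "0 \<le> s u * (cmod (h (s u * u)))\<^sup>2" for u
      using s[of u] by simp
    show "s a * (cmod (h (s a * a)))\<^sup>2 \<noteq> 0"
      using s[of a] \<open>h y \<noteq> 0\<close> \<open>s a * a = y\<close> by simp
  qed
qed

text \<open>Dominated convergence with the majorant of \<open>profile_bound\<close>. Convergence is
  asked of the translated scales rather than of \<open>X\<close>, which admits sequences escaping to
  infinity.\<close>

lemma frame_weight_tendsto:
  assumes cont: "continuous_on UNIV \<sigma>" and lower: "\<And>t. m \<le> \<sigma> t" and upper: "\<And>t. \<sigma> t \<le> M"
    and s: "s \<in> borel_measurable borel" and lim: "\<And>u. (\<lambda>n. \<sigma> (X n - u)) \<longlonglongrightarrow> s u"
  shows "(\<lambda>n. frame_weight h \<sigma> (X n)) \<longlonglongrightarrow> (LINT u|lborel. s u * (cmod (h (s u * u)))\<^sup>2)"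
  unfolding frame_weight_shifted
proof (rule integral_dominated_convergence[where w = "\<lambda>u. (sqrt M * \<Psi>)\<^sup>2 * (1 / (1 + m * \<bar>u\<bar>))\<^sup>2"])
  note [measurable] = s borel_measurable_continuous_onI[OF cont]
  show "(\<lambda>u. s u * (cmod (h (s u * u)))\<^sup>2) \<in> borel_measurable lborel" by measurable
  show "(\<lambda>u. \<sigma> (X n - u) * (cmod (h (\<sigma> (X n - u) * u)))\<^sup>2) \<in> borel_measurable lborel" for n
    by measurable
  show "integrable lborel (\<lambda>u. (sqrt M * \<Psi>)\<^sup>2 * (1 / (1 + m * \<bar>u\<bar>))\<^sup>2)"
    by (intro integrable_mult_right decay_integrable m_pos)
  show "AE u in lborel. (\<lambda>n. \<sigma> (X n - u) * (cmod (h (\<sigma> (X n - u) * u)))\<^sup>2) \<longlonglongrightarrow> s u * (cmod (h (s u * u)))\<^sup>2"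
    by (intro AE_I2 tendsto_intros lim continuous_on_tendsto_compose[OF h_continuous]) auto
  show "AE u in lborel. norm (\<sigma> (X n - u) * (cmod (h (\<sigma> (X n - u) * u)))\<^sup>2)
      \<le> (sqrt M * \<Psi>)\<^sup>2 * (1 / (1 + m * \<bar>u\<bar>))\<^sup>2" for n
    using profile_bound[OF lower upper] by simp
qed

text \<open>Compactness of the extended reals: along a sequence on which the weight tends to its infimum, a
  subsequence converges to a real number or to \<open>\<pm>\<infinity>\<close>, and the limit of the weight is positive
  in either case.\<close>

lemma frame_weight_lower_bound:
  assumes \<sigma>: "\<sigma> \<in> Phi_class m" and h: "h y \<noteq> 0"
  shows "\<exists>\<epsilon>>0. \<forall>x. \<epsilon> \<le> frame_weight h \<sigma> x"
proof (rule ccontr)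
  assume contra: "\<not> ?thesis"
  have cont: "continuous_on UNIV \<sigma>" and lower: "\<And>t. m \<le> \<sigma> t"
    and top: "(\<sigma> \<longlongrightarrow> 1) at_top" and bot: "(\<sigma> \<longlongrightarrow> 1) at_bot"
    using \<sigma> by (auto simp: Phi_class_def)
  obtain M where upper: "\<And>t. \<sigma> t \<le> M"
    using Phi_class_bounded[OF \<sigma>] by blast
  \<comment> \<open>Without a positive lower bound the weight falls below every
    \<open>1 / (n + 1)\<close>; being nonnegative, it tends to 0 along the chosen points.\<close>
  have "\<exists>x. frame_weight h \<sigma> x < inverse (real (Suc n))" for n
    using contra by (auto simp: not_le)
  then obtain X where X: "\<And>n. frame_weight h \<sigma> (X n) < inverse (real (Suc n))"
    by metis
  obtain l r where r: "strict_mono r" and l: "((\<lambda>n. ereal (X n)) \<circ> r) \<longlonglongrightarrow> l"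
    using compact_complete_linorder by blast
  have "(\<lambda>n. frame_weight h \<sigma> (X n)) \<longlonglongrightarrow> 0"
  proof (rule real_tendsto_sandwich[OF _ _ tendsto_const LIMSEQ_inverse_real_of_nat])
    show "\<forall>\<^sub>F n in sequentially. 0 \<le> frame_weight h \<sigma> (X n)"
      by (simp add: frame_weight_eq_norm[OF lower])
    show "\<forall>\<^sub>F n in sequentially. frame_weight h \<sigma> (X n) \<le> inverse (real (Suc n))"
      by (intro always_eventually allI less_imp_le X)
  qed
  then have zero: "(\<lambda>n. frame_weight h \<sigma> (X (r n))) \<longlonglongrightarrow> 0"
    using LIMSEQ_subseq_LIMSEQ[OF _ r] by (auto simp: o_def)
  \<comment> \<open>The limiting scale is \<open>\<sigma> (a - u)\<close> at a finite limit
    \<open>a\<close> and the constant 1 at either infinity. It inherits the bounds \<open>m\<close>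
    and \<open>M\<close>, which \<open>profile_integral_pos\<close> requires.\<close>
  have "\<exists>s. continuous_on UNIV s \<and> (\<forall>u. m \<le> s u) \<and> (\<forall>u. s u \<le> M) \<and> (\<forall>u. (\<lambda>n. \<sigma> (X (r n) - u)) \<longlonglongrightarrow> s u)"
  proof (cases l)
    case (real a)
    then have "(\<lambda>n. X (r n)) \<longlonglongrightarrow> a"
      using l by (simp add: o_def)
    then have "(\<lambda>n. \<sigma> (X (r n) - u)) \<longlonglongrightarrow> \<sigma> (a - u)" for u
      by (intro continuous_on_tendsto_compose[OF cont] tendsto_intros) auto
    then show ?thesis
      using lower upper by (intro exI[of _ "\<lambda>u. \<sigma> (a - u)"])
         (auto intro!: continuous_on_compose2[OF cont] continuous_intros)
  next
    case PInf
    then have "filterlim (\<lambda>n. X (r n)) at_top sequentially"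
      using l by (simp add: o_def tendsto_PInfty_eq_at_top)
    then have lim: "filterlim (\<lambda>n. X (r n) - u) at_top sequentially" for u
      using filterlim_tendsto_add_at_top[OF tendsto_const, of "\<lambda>n. X (r n)" sequentially "- u"]
      by (simp add: add.commute)
    have "m \<le> 1" "1 \<le> M"
      using tendsto_lowerbound[OF top, of m] tendsto_upperbound[OF top, of M] lower upper by auto
    then show ?thesis
      using filterlim_compose[OF top lim] by (intro exI[of _ "\<lambda>u. 1"]) auto
  next
    case MInf
    then have "filterlim (\<lambda>n. - X (r n)) at_top sequentially"
      using tendsto_uminus_ereal[OF l] by (simp add: o_def tendsto_PInfty_eq_at_top)
    then have "filterlim (\<lambda>n. u + - X (r n)) at_top sequentially" for u
      by (rule filterlim_tendsto_add_at_top[OF tendsto_const])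
    then have lim: "filterlim (\<lambda>n. X (r n) - u) at_bot sequentially" for u
      by (simp add: filterlim_uminus_at_top)
    have "m \<le> 1" "1 \<le> M"
      using tendsto_lowerbound[OF top, of m] tendsto_upperbound[OF top, of M] lower upper by auto
    then show ?thesis
      using filterlim_compose[OF bot lim] by (intro exI[of _ "\<lambda>u. 1"]) auto
  qed
  then obtain s where s: "continuous_on UNIV s" "\<And>u. m \<le> s u" "\<And>u. s u \<le> M"
    and lim: "\<And>u. (\<lambda>n. \<sigma> (X (r n) - u)) \<longlonglongrightarrow> s u"
    by blast
  have "(LINT u|lborel. s u * (cmod (h (s u * u)))\<^sup>2) = 0"
    by (rule LIMSEQ_unique[OF frame_weight_tendsto[OF cont lower upper borel_measurable_continuous_onI[OF s(1)] lim] zero])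
  with profile_integral_pos[OF s h] show False by simp
qed

end

section \<open>Lipschitz dependence of the left inverse\<close>

theorem proposition2:
  fixes \<sigma>min :: real
    and h :: "real \<Rightarrow> complex"
    and \<psi> \<phi> :: "real \<Rightarrow> real"
    and \<sigma> \<kappa> :: "real \<Rightarrow> real"
  assumes "0 < \<sigma>min" and "\<sigma>min < 1"
    and "h C1_differentiable_on UNIV"
    and "\<exists>x. h x \<noteq> 0"
    and "continuous_on UNIV \<psi>" and "\<And>t. 0 \<le> \<psi> t" and "bounded (range \<psi>)"
    and "continuous_on UNIV \<phi>" and "\<And>t. 0 \<le> \<phi> t" and "bounded (range \<phi>)"
    and "\<And>t. cmod (h t) \<le> \<psi> t / (1 + \<bar>t\<bar>)"
    and "\<And>t. cmod (vector_derivative h (at t)) \<le> \<phi> t / (1 + t\<^sup>2)"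
    and "\<sigma> \<in> Phi_class \<sigma>min" and "\<kappa> \<in> Phi_class \<sigma>min"
  shows "\<exists>C\<^sub>2::real. \<forall>F \<in> L2_space (lborel :: (real \<times> real) measure).
           (\<lambda>x. left_inverse h \<sigma> F x - left_inverse h \<kappa> F x) \<in> L2_space lborel \<and>
           L2_norm lborel (\<lambda>x. left_inverse h \<sigma> F x - left_inverse h \<kappa> F x)
             \<le> C\<^sub>2 * Linf_norm (\<lambda>t. \<sigma> t - \<kappa> t) * L2_norm lborel F"
proof -
  obtain \<Psi> where \<Psi>: "\<And>t. \<psi> t \<le> \<Psi>"
    using \<open>bounded (range \<psi>)\<close> by (auto simp: bounded_iff abs_le_iff)
  obtain \<Phi> where \<Phi>: "\<And>t. \<phi> t \<le> \<Phi>"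
    using \<open>bounded (range \<phi>)\<close> by (auto simp: bounded_iff abs_le_iff)
  interpret window h "\<lambda>t. vector_derivative h (at t)" \<Psi> \<Phi> \<sigma>min
  proof
    show "0 \<le> \<Psi>" "0 \<le> \<Phi>"
      using \<Psi>[of 0] \<Phi>[of 0] assms(6)[of 0] assms(9)[of 0] by linarith+
    show "(h has_vector_derivative vector_derivative h (at t)) (at t)" for t
      using assms(3) by (simp add: C1_differentiable_on_eq vector_derivative_works)
    show "cmod (h t) \<le> \<Psi> / (1 + \<bar>t\<bar>)" for t
      using assms(11)[of t] divide_right_mono[OF \<Psi>[of t], of "1 + \<bar>t\<bar>"] by simp
    show "cmod (vector_derivative h (at t)) \<le> \<Phi> / (1 + t\<^sup>2)" for t
      using assms(12)[of t] divide_right_mono[OF \<Phi>[of t], of "1 + t\<^sup>2"] by simp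
  qed (rule assms(1))
  obtain y where y: "h y \<noteq> 0" using assms(4) by blast
  obtain M\<^sub>1 M\<^sub>2 where M12: "\<And>t. \<sigma> t \<le> M\<^sub>1" "\<And>t. \<kappa> t \<le> M\<^sub>2"
    using Phi_class_bounded[OF assms(13)] Phi_class_bounded[OF assms(14)] by metis
  \<comment> \<open>One upper bound for both scale functions, so that their kernels share an
    envelope.\<close>
  define M where "M = max M\<^sub>1 M\<^sub>2"
  have \<sigma>: "continuous_on UNIV \<sigma>" "\<And>t. \<sigma>min \<le> \<sigma> t" "\<And>t. \<sigma> t \<le> M"
    and \<kappa>: "continuous_on UNIV \<kappa>" "\<And>t. \<sigma>min \<le> \<kappa> t" "\<And>t. \<kappa> t \<le> M"
    using assms(13,14) M12 by (auto simp: Phi_class_def M_def le_max_iff_disj)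
  define \<delta> where "\<delta> = Linf_norm (\<lambda>t. \<sigma> t - \<kappa> t)"
  have diff: "\<bar>\<sigma> t - \<kappa> t\<bar> \<le> \<delta>" for t
    unfolding \<delta>_def
  proof (rule abs_le_Linf_norm)
    show "continuous_on UNIV (\<lambda>t. \<sigma> t - \<kappa> t)"
      by (intro continuous_intros \<sigma> \<kappa>)
    \<comment> \<open>Both values lie between the positive \<open>\<sigma>min\<close> and
      \<open>M\<close>, so they differ by at most \<open>M\<close>.\<close>
    show "\<bar>\<sigma> t - \<kappa> t\<bar> \<le> M" for t
      using \<sigma>(2,3)[of t] \<kappa>(2,3)[of t] m_pos by linarith
  qed
  have "0 \<le> \<delta>" using diff[of 0] by linarith
  let ?k\<sigma> = "frame_weight h \<sigma>" and ?k\<kappa> = "frame_weight h \<kappa>"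
  obtain \<epsilon>\<^sub>1 \<epsilon>\<^sub>2 where eps: "0 < \<epsilon>\<^sub>1" "\<And>x. \<epsilon>\<^sub>1 \<le> ?k\<sigma> x" "0 < \<epsilon>\<^sub>2" "\<And>x. \<epsilon>\<^sub>2 \<le> ?k\<kappa> x"
    using frame_weight_lower_bound[OF assms(13) y] frame_weight_lower_bound[OF assms(14) y] by metis
  note [measurable] = frame_weight_measurable[OF \<sigma>(1)] frame_weight_measurable[OF \<kappa>(1)]
  \<comment> \<open>\<open>c * E\<close> bounds the norm of each adjoint,
    \<open>Lip * \<delta> * E\<close> that of their difference, and \<open>K * \<delta>\<close> the
    difference of the frame weights.\<close>
  define E K c where "E = sqrt (decay_energy \<sigma>min)" and "K = 2 * sqrt M * \<Psi> * Lip * decay_energy \<sigma>min"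
    and "c = sqrt M * \<Psi>"
  note p\<sigma> = dilation_decaying[OF \<sigma>] and p\<kappa> = dilation_decaying[OF \<kappa>]
    and pd = dilation_diff_decaying[OF \<sigma>(1,2) \<kappa>(1,2) diff]
  let ?u = "\<lambda>x. complex_of_real (1 / ?k\<sigma> x - 1 / ?k\<kappa> x)" and ?v = "\<lambda>x. complex_of_real (1 / ?k\<kappa> x)"
  have u_bound: "cmod (?u x) \<le> K * \<delta> / (\<epsilon>\<^sub>1 * \<epsilon>\<^sub>2)" for x
  proof -
    have pos: "0 < ?k\<sigma> x" "0 < ?k\<kappa> x" using eps less_le_trans by blast+
    then have "cmod (?u x) = \<bar>?k\<sigma> x - ?k\<kappa> x\<bar> / (?k\<sigma> x * ?k\<kappa> x)"
      unfolding norm_of_real by (simp add: diff_frac_eq abs_divide abs_minus_commute)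
    also have "\<dots> \<le> K * \<delta> / (\<epsilon>\<^sub>1 * \<epsilon>\<^sub>2)"
    proof (rule frac_le)
      show "\<bar>?k\<sigma> x - ?k\<kappa> x\<bar> \<le> K * \<delta>"
        unfolding K_def by (rule frame_weight_diff[OF \<sigma> \<kappa> diff])
      then show "0 \<le> K * \<delta>" by linarith
      show "\<epsilon>\<^sub>1 * \<epsilon>\<^sub>2 \<le> ?k\<sigma> x * ?k\<kappa> x"
        using eps pos by (intro mult_mono) (auto intro: less_imp_le)
    qed (use eps in auto)
    finally show ?thesis .
  qed
  have v_bound: "cmod (?v x) \<le> 1 / \<epsilon>\<^sub>2" for x
  proof -
    have "0 < ?k\<kappa> x" using eps less_le_trans by blast
    then show ?thesis unfolding norm_of_real using eps by (simp add: frac_le)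
  qed
  have main: "(\<lambda>x. left_inverse h \<sigma> F x - left_inverse h \<kappa> F x) \<in> L2_space lborel \<and>
      L2_norm lborel (\<lambda>x. left_inverse h \<sigma> F x - left_inverse h \<kappa> F x)
        \<le> (K * c * E / (\<epsilon>\<^sub>1 * \<epsilon>\<^sub>2) + Lip * E / \<epsilon>\<^sub>2) * \<delta> * L2_norm lborel F"
    if F: "F \<in> L2_space lborel" for F
  proof -
    let ?G = "L2_adjoint lborel lborel (transform h \<sigma>) F" and ?H = "L2_adjoint lborel lborel (transform h \<kappa>) F"
    have G: "?G \<in> L2_space lborel" and H: "?H \<in> L2_space lborel"
      unfolding transform_eq
      by (rule decaying_kernel.kernel_adjoint_L2[OF p\<sigma> F] decaying_kernel.kernel_adjoint_L2[OF p\<kappa> F])+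
    have D: "(\<lambda>x. ?G x - ?H x) \<in> L2_space lborel"
      by (rule L2_space_diff[OF G H])
    \<comment> \<open>Add and subtract \<open>?v x * ?G x\<close>: each summand then has one small
      factor, the multiplier \<open>?u\<close> in the first and the difference of adjoints in the
      second.\<close>
    have split: "(\<lambda>x. left_inverse h \<sigma> F x - left_inverse h \<kappa> F x) = (\<lambda>x. ?u x * ?G x + ?v x * (?G x - ?H x))"
      by (simp add: left_inverse_def fun_eq_iff algebra_simps)
    have uG: "(\<lambda>x. ?u x * ?G x) \<in> L2_space lborel"
      by (rule L2_space_bounded_mult[OF G _ u_bound]) measurable
    have vD: "(\<lambda>x. ?v x * (?G x - ?H x)) \<in> L2_space lborel"
      by (rule L2_space_bounded_mult[OF D _ v_bound]) measurable
    have "L2_norm lborel (\<lambda>x. left_inverse h \<sigma> F x - left_inverse h \<kappa> F x)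
        \<le> L2_norm lborel (\<lambda>x. ?u x * ?G x) + L2_norm lborel (\<lambda>x. ?v x * (?G x - ?H x))"
      unfolding split by (rule L2_norm_triangle[OF uG vD])
    also have "\<dots> \<le> K * \<delta> / (\<epsilon>\<^sub>1 * \<epsilon>\<^sub>2) * L2_norm lborel ?G + 1 / \<epsilon>\<^sub>2 * L2_norm lborel (\<lambda>x. ?G x - ?H x)"
      by (intro add_mono L2_norm_bounded_mult G D u_bound v_bound) measurable
    also have "\<dots> \<le> K * \<delta> / (\<epsilon>\<^sub>1 * \<epsilon>\<^sub>2) * (c * E * L2_norm lborel F)
        + 1 / \<epsilon>\<^sub>2 * (Lip * \<delta> * E * L2_norm lborel F)"
    proof (intro add_mono mult_left_mono)
      show "L2_norm lborel ?G \<le> c * E * L2_norm lborel F"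
        unfolding transform_eq c_def E_def
        by (rule decaying_kernel.kernel_adjoint_norm[OF p\<sigma> F])
      show "L2_norm lborel (\<lambda>x. ?G x - ?H x) \<le> Lip * \<delta> * E * L2_norm lborel F"
        unfolding transform_eq E_def
        by (rule kernel_adjoint_diff_norm[OF p\<sigma> p\<kappa> pd F])
      \<comment> \<open>Nonnegativity is inherited from the modulus that this number bounds.\<close>
      show "0 \<le> K * \<delta> / (\<epsilon>\<^sub>1 * \<epsilon>\<^sub>2)"
        using u_bound[of 0] norm_ge_zero order_trans by blast
      show "0 \<le> 1 / \<epsilon>\<^sub>2" using eps by simp
    qed
    also have "\<dots> = (K * c * E / (\<epsilon>\<^sub>1 * \<epsilon>\<^sub>2) + Lip * E / \<epsilon>\<^sub>2) * \<delta> * L2_norm lborel F"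
      by (simp add: algebra_simps)
    finally show ?thesis
      using L2_space_add[OF uG vD] split by simp
  qed
  show ?thesis
    using main unfolding \<delta>_def by blast
qed

end
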